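(* Let $G$ be a Kleinian group and let $P\subset\mathbb{H}^3$ be a fundamental polyhedron for $G$. Suppose that no face pairing transformation of $P$ is elliptic and that, for every edge class of $P$, the sum of the interior dihedral angles of $P$ at the edges of the class equals $2\pi$. Then $G$ is torsion-free.
   Context: A Kleinian group is a discrete group of orientation-preserving isometries of $\mathbb{H}^3$. A fundamental polyhedron $P$ for $G$ is a convex polyhedron in $\mathbb{H}^3$ with the following properties. (i) Its faces are arranged in pairs $(\sigma,\sigma')$ of distinct faces; to each pair corresponds an element $g\in G$ (a face identification, or face pairing transformation) with $g(\sigma)=\sigma'$ and $g(P)\cap P=\sigma'$. (ii) If a face pairing transformation is elliptic, there is an edge of $P$ contained in its rotation axis. (iii) To each edge $e$ corresponds an edge relation, obtained by following $e$ through successive face identifications (each time passing to the other face containing the current edge) until one returns to $e$; the resulting product $g_1g_2\cdots g_n=g_e$ is either an elliptic of finite order whose rotation axis contains $e$, or the identity. The set of edges met in this process is the edge class of $e$. (iv) The translates $h(P)$, $h\in G$, fill $\mathbb{H}^3$ without overlap of interiors. (v) The face pairing transformations generate $G$ and the edge relations generate the relations of $G$. *)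

theory Defs
  imports "HOL-Analysis.Analysis" "HOL-Algebra.Bij" "HOL-Algebra.Generated_Groups"
    "HOL-Algebra.Multiplicative_Group"
begin

section \<open>Hyperbolic 3-space\<close>

text \<open>
  Hyperbolic 3-space is the open unit ball of the projective (Klein) model.  Hyperbolic lines and
  planes are the intersections of the ball with Euclidean lines and planes, so hyperbolic convexity,
  faces and edges are the affine notions of the library, and the topology is the Euclidean one.
  The Klein metric is not conformal: lengths and angles are computed in the hyperboloid model, where
  \<open>x\<close> corresponds to the ray through \<open>(1, x)\<close>.  Vectors of Minkowski space are pairs (time, space).
\<close>

type_synonym point = "real ^ 3"

abbreviation H3 :: "point set" where
  "H3 \<equiv> ball 0 1"

definition lorentz :: "real \<times> point \<Rightarrow> real \<times> point \<Rightarrow> real" where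
  "lorentz u v = snd u \<bullet> snd v - fst u * fst v"

definition hyp_dist :: "point \<Rightarrow> point \<Rightarrow> real" where
  "hyp_dist x y =
     arcosh (- lorentz (1, x) (1, y) /
             (sqrt (- lorentz (1, x) (1, x)) * sqrt (- lorentz (1, y) (1, y))))"

text \<open>Maps of \<open>H3\<close> are extensional functions (value \<open>undefined\<close> off \<open>H3\<close>), as in \<^const>\<open>BijGroup\<close>.\<close>

definition orientation_preserving_isometries :: "(point \<Rightarrow> point) set" where
  "orientation_preserving_isometries =
     {f \<in> Bij H3.
        (\<forall>x\<in>H3. \<forall>y\<in>H3. hyp_dist (f x) (f y) = hyp_dist x y) \<and>
        (\<forall>x\<in>H3. \<exists>f'. (f has_derivative f') (at x) \<and> det (matrix f') > 0)}"

text \<open>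
  Discreteness refers to the library topology on functions, that is, pointwise convergence.  On
  isometry groups it coincides with the compact-open topology.
\<close>

definition kleinian_group :: "(point \<Rightarrow> point) set \<Rightarrow> bool" where
  "kleinian_group G \<longleftrightarrow>
     subgroup G (BijGroup H3) \<and> G \<subseteq> orientation_preserving_isometries \<and> discrete G"

definition elliptic :: "(point \<Rightarrow> point) \<Rightarrow> bool" where
  "elliptic g \<longleftrightarrow>
     g \<in> orientation_preserving_isometries \<and> g \<noteq> \<one>\<^bsub>BijGroup H3\<^esub> \<and> (\<exists>x\<in>H3. g x = x)"

text \<open>For an elliptic \<open>g\<close> the fixed point set in \<open>H3\<close> is a hyperbolic line.\<close>

definition rotation_axis :: "(point \<Rightarrow> point) \<Rightarrow> point set" where
  "rotation_axis g = {x \<in> H3. g x = x}"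

definition torsion_free :: "(point \<Rightarrow> point) set \<Rightarrow> bool" where
  "torsion_free G \<longleftrightarrow>
     (\<forall>g\<in>G. \<forall>n::nat. n > 0 \<longrightarrow> g [^]\<^bsub>BijGroup H3\<^esub> n = \<one>\<^bsub>BijGroup H3\<^esub> \<longrightarrow> g = \<one>\<^bsub>BijGroup H3\<^esub>)"


section \<open>Convex polyhedra and dihedral angles\<close>

text \<open>
  A convex polyhedron may have infinitely many faces, but only finitely many of the bounding planes
  meet a compact subset of \<open>H3\<close>.  Its faces are its 2-dimensional faces (\<^const>\<open>facet_of\<close>) and its
  edges the 1-dimensional ones (\<^const>\<open>edge_of\<close>); points at infinity do not belong to them.
\<close>

definition convex_polyhedron :: "point set \<Rightarrow> bool" where
  "convex_polyhedron P \<longleftrightarrow>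
     interior P \<noteq> {} \<and>
     (\<exists>\<H>. (\<forall>h\<in>\<H>. \<exists>a b. b \<noteq> 0 \<and> h = {x. b \<bullet> x \<le> a}) \<and>
          (\<forall>K. compact K \<and> K \<subseteq> H3 \<longrightarrow> finite {h \<in> \<H>. frontier h \<inter> K \<noteq> {}}) \<and>
          P = H3 \<inter> \<Inter>\<H>)"

text \<open>
  The half-space \<open>b \<bullet> x \<le> a\<close> is \<open>lorentz (a, b) (1, x) \<le> 0\<close>.  The Minkowski vector \<open>(a, b)\<close>, scaled to
  be a unit spacelike vector, is the outward unit normal of the bounding plane at each of its points
  in the hyperboloid model.
\<close>

definition outward_normal :: "point set \<Rightarrow> point set \<Rightarrow> real \<times> point" where
  "outward_normal P \<sigma> =
     (THE n. lorentz n n = 1 \<and> (\<forall>x\<in>P. lorentz n (1, x) \<le> 0) \<and> (\<forall>x\<in>\<sigma>. lorentz n (1, x) = 0))"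

text \<open>The interior angle is \<open>\<pi>\<close> minus the angle between the outward normals of the two faces.\<close>

definition dihedral_angle :: "point set \<Rightarrow> point set \<Rightarrow> real" where
  "dihedral_angle P e =
     (THE \<theta>. \<exists>\<sigma> \<tau>. \<sigma> facet_of P \<and> \<tau> facet_of P \<and> \<sigma> \<noteq> \<tau> \<and> e \<subseteq> \<sigma> \<and> e \<subseteq> \<tau> \<and>
        \<theta> = pi - arccos (lorentz (outward_normal P \<sigma>) (outward_normal P \<tau>)))"

definition other_face :: "point set \<Rightarrow> point set \<Rightarrow> point set \<Rightarrow> point set" where
  "other_face P e \<sigma> = (THE \<tau>. \<tau> facet_of P \<and> e \<subseteq> \<tau> \<and> \<tau> \<noteq> \<sigma>)"


section \<open>Face pairings and edge cycles\<close>

text \<open>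
  A face pairing is given by an involution \<open>opp\<close> on the faces (\<open>opp \<sigma> = \<sigma>'\<close>) and a family \<open>g\<close> of
  isometries, \<open>g \<sigma>\<close> mapping \<open>\<sigma>\<close> to \<open>opp \<sigma>\<close>.  A flag is an edge together with a face containing it,
  namely the face whose identification is applied next.
\<close>

type_synonym flag = "point set \<times> point set"

definition next_flag ::
    "point set \<Rightarrow> (point set \<Rightarrow> point set) \<Rightarrow> (point set \<Rightarrow> point \<Rightarrow> point) \<Rightarrow> flag \<Rightarrow> flag" where
  "next_flag P opp g = (\<lambda>(e, \<sigma>). (g \<sigma> ` e, other_face P (g \<sigma> ` e) (opp \<sigma>)))"

definition edge_returns ::
    "point set \<Rightarrow> (point set \<Rightarrow> point set) \<Rightarrow> (point set \<Rightarrow> point \<Rightarrow> point) \<Rightarrow> flag \<Rightarrow> nat \<Rightarrow> bool" where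
  "edge_returns P opp g fl n \<longleftrightarrow> n > 0 \<and> fst ((next_flag P opp g ^^ n) fl) = fst fl"

definition cycle_length ::
    "point set \<Rightarrow> (point set \<Rightarrow> point set) \<Rightarrow> (point set \<Rightarrow> point \<Rightarrow> point) \<Rightarrow> flag \<Rightarrow> nat" where
  "cycle_length P opp g fl = (LEAST n. edge_returns P opp g fl n)"

definition edge_class ::
    "point set \<Rightarrow> (point set \<Rightarrow> point set) \<Rightarrow> (point set \<Rightarrow> point \<Rightarrow> point) \<Rightarrow> flag \<Rightarrow> point set set" where
  "edge_class P opp g fl =
     (\<lambda>i. fst ((next_flag P opp g ^^ i) fl)) ` {..<cycle_length P opp g fl}"

text \<open>
  Words in the face identifications are lists of faces.  Maps act on the left, so in the cycle word
  the face used first comes last.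
\<close>

definition word_value :: "(point set \<Rightarrow> point \<Rightarrow> point) \<Rightarrow> point set list \<Rightarrow> (point \<Rightarrow> point)" where
  "word_value g w = foldr (\<lambda>\<sigma> h. g \<sigma> \<otimes>\<^bsub>BijGroup H3\<^esub> h) w \<one>\<^bsub>BijGroup H3\<^esub>"

definition cycle_word ::
    "point set \<Rightarrow> (point set \<Rightarrow> point set) \<Rightarrow> (point set \<Rightarrow> point \<Rightarrow> point) \<Rightarrow> flag \<Rightarrow> point set list" where
  "cycle_word P opp g fl =
     rev (map (\<lambda>i. snd ((next_flag P opp g ^^ i) fl)) [0..<cycle_length P opp g fl])"

definition cycle_transformation ::
    "point set \<Rightarrow> (point set \<Rightarrow> point set) \<Rightarrow> (point set \<Rightarrow> point \<Rightarrow> point) \<Rightarrow> flag \<Rightarrow> (point \<Rightarrow> point)" where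
  "cycle_transformation P opp g fl = word_value g (cycle_word P opp g fl)"

text \<open>
  The relation of an edge is \<open>g\<^sub>e ^ k = 1\<close>, where \<open>k\<close> is the order of the cycle transformation \<open>g\<^sub>e\<close>
  (\<open>k = 1\<close> if \<open>g\<^sub>e\<close> is the identity).
\<close>

definition edge_relators ::
    "point set \<Rightarrow> (point set \<Rightarrow> point set) \<Rightarrow> (point set \<Rightarrow> point \<Rightarrow> point) \<Rightarrow> point set list set" where
  "edge_relators P opp g =
     {concat (replicate (group.ord (BijGroup H3) (cycle_transformation P opp g (e, \<sigma>)))
                        (cycle_word P opp g (e, \<sigma>)))
      | e \<sigma>. e edge_of P \<and> \<sigma> facet_of P \<and> e \<subseteq> \<sigma>}"

text \<open>
  The letter \<open>opp \<sigma>\<close> is the formal inverse of \<open>\<sigma>\<close>; \<open>inverse_relators\<close> expresses this cancellation, so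
  that the free group on the pairs of faces consists of the words modulo these relators.
\<close>

definition inverse_relators :: "point set \<Rightarrow> (point set \<Rightarrow> point set) \<Rightarrow> point set list set" where
  "inverse_relators P opp = {[\<sigma>, opp \<sigma>] | \<sigma>. \<sigma> facet_of P}"

text \<open>Words that become trivial by inserting and deleting relators.\<close>

inductive trivial_word :: "'a list set \<Rightarrow> 'a list \<Rightarrow> bool" for R where
  empty: "trivial_word R []"
| insert: "r \<in> R \<Longrightarrow> trivial_word R (u @ v) \<Longrightarrow> trivial_word R (u @ r @ v)"
| delete: "r \<in> R \<Longrightarrow> trivial_word R (u @ r @ v) \<Longrightarrow> trivial_word R (u @ v)"


section \<open>Fundamental polyhedra\<close>

definition face_pairing ::
    "(point \<Rightarrow> point) set \<Rightarrow> point set \<Rightarrow> (point set \<Rightarrow> point set) \<Rightarrow> (point set \<Rightarrow> point \<Rightarrow> point) \<Rightarrow> bool"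
  where
  "face_pairing G P opp g \<longleftrightarrow>
     (\<forall>\<sigma>. \<sigma> facet_of P \<longrightarrow>
        opp \<sigma> facet_of P \<and> opp \<sigma> \<noteq> \<sigma> \<and> opp (opp \<sigma>) = \<sigma> \<and>
        g \<sigma> \<in> G \<and> g (opp \<sigma>) = inv\<^bsub>BijGroup H3\<^esub> (g \<sigma>) \<and>
        g \<sigma> ` \<sigma> = opp \<sigma> \<and> g \<sigma> ` P \<inter> P = opp \<sigma>)"

definition fundamental_polyhedron ::
    "(point \<Rightarrow> point) set \<Rightarrow> point set \<Rightarrow> (point set \<Rightarrow> point set) \<Rightarrow> (point set \<Rightarrow> point \<Rightarrow> point) \<Rightarrow> bool"
  where
  "fundamental_polyhedron G P opp g \<longleftrightarrow>
     convex_polyhedron P \<and>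
     face_pairing G P opp g \<and>
     (\<forall>\<sigma>. \<sigma> facet_of P \<and> elliptic (g \<sigma>) \<longrightarrow> (\<exists>e. e edge_of P \<and> e \<subseteq> rotation_axis (g \<sigma>))) \<and>
     (\<forall>e \<sigma>. e edge_of P \<and> \<sigma> facet_of P \<and> e \<subseteq> \<sigma> \<longrightarrow>
        (\<exists>n. edge_returns P opp g (e, \<sigma>) n) \<and>
        (let ge = cycle_transformation P opp g (e, \<sigma>) in
           elliptic ge \<and> group.ord (BijGroup H3) ge > 0 \<and> e \<subseteq> rotation_axis ge \<or>
           ge = \<one>\<^bsub>BijGroup H3\<^esub>)) \<and>
     (\<Union>h\<in>G. h ` P) = H3 \<and>
     (\<forall>h\<in>G. \<forall>k\<in>G. h \<noteq> k \<longrightarrow> interior (h ` P) \<inter> interior (k ` P) = {}) \<and>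
     generate (BijGroup H3) {g \<sigma> | \<sigma>. \<sigma> facet_of P} = G \<and>
     (\<forall>w \<in> lists {\<sigma>. \<sigma> facet_of P}.
        word_value g w = \<one>\<^bsub>BijGroup H3\<^esub> \<longleftrightarrow>
        trivial_word (inverse_relators P opp \<union> edge_relators P opp g) w)"

end

theory Submission
  imports Defs
begin

text \<open>
  Suppose that a nontrivial element \<open>f\<close> of \<open>G\<close> has finite order.  It has a fixed point, and since it
  preserves orientation it fixes a whole line, its axis, pointwise.  The tiles \<open>h ` P\<close> cover the axis and
  there are only countably many of them, so one of them contains a segment of the axis.  After
  conjugation this tile is \<open>P\<close> itself: some \<open>k \<noteq> 1\<close> in \<open>G\<close> fixes a segment in \<open>P\<close> pointwise.  Passing to a
  segment is what keeps vertices out of the argument, because the midpoint \<open>x\<close> of a segment in \<open>P\<close> is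
  inside \<open>P\<close>, inside a facet or inside an edge (\<open>convex_polyhedron_local_structure\<close>).

  In the interior of \<open>P\<close> a fixed point is impossible, as the tiles \<open>P\<close> and \<open>k ` P\<close> would overlap.  If \<open>x\<close> is
  inside a facet, only one tile besides \<open>P\<close> has room at \<open>x\<close>, namely the image of \<open>P\<close> under a face pairing
  transformation (\<open>only_tile_beyond_wall\<close>).  So \<open>k\<close> is this transformation, and it is elliptic, contrary
  to the assumption.  If \<open>x\<close> is inside an edge \<open>e\<close>, count angles.  Each edge \<open>e'\<close> in the class of \<open>e\<close> is the
  image of \<open>e\<close> under some \<open>h\<close> in \<open>G\<close>, and the tile \<open>h\<^sup>-\<^sup>1 P\<close> contributes the dihedral angle of \<open>P\<close> at \<open>e'\<close> to the
  directions around \<open>e\<close>.  These contributions do not overlap, because distinct tiles have disjoint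
  interiors, and they add up to \<open>2 * pi\<close>.  So there is no room for the further tile \<open>k\<^sup>-\<^sup>1 P\<close>, which has
  a positive angle at \<open>e\<close> as well (\<open>sum_dihedral_angles_le\<close>, \<open>fixes_edge_imp_one\<close>).

  The metric enters through linear algebra: an isometry of \<open>H3\<close> lifts to a linear map of Minkowski space
  that preserves the Lorentz form (\<open>isometry_lifts\<close>).  Hence isometries map lines to lines and faces to
  faces, finite orbits have a centre, the derivative at a fixed point is a rotation, and the angle
  between outward normals is invariant.
\<close>

section \<open>Isometries as Lorentz maps\<close>

text \<open>The point of the hyperboloid on the ray through \<open>(1, x)\<close>.\<close>

definition lift :: "point \<Rightarrow> real \<times> point" where
  "lift x = (1 / sqrt (1 - x \<bullet> x)) *\<^sub>R (1, x)"

lemma mem_H3_iff: "x \<in> H3 \<longleftrightarrow> x \<bullet> x < 1"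
  by (simp add: norm_eq_sqrt_inner)

lemma lorentz_add_left: "lorentz (u + v) w = lorentz u w + lorentz v w"
  and lorentz_add_right: "lorentz w (u + v) = lorentz w u + lorentz w v"
  and lorentz_diff_left: "lorentz (u - v) w = lorentz u w - lorentz v w"
  and lorentz_diff_right: "lorentz w (u - v) = lorentz w u - lorentz w v"
  and lorentz_scaleR_left: "lorentz (c *\<^sub>R u) w = c * lorentz u w"
  and lorentz_scaleR_right: "lorentz w (c *\<^sub>R u) = c * lorentz w u"
  by (auto simp: lorentz_def algebra_simps inner_simps)

lemmas lorentz_linear =
  lorentz_add_left lorentz_add_right lorentz_diff_left lorentz_diff_right
  lorentz_scaleR_left lorentz_scaleR_right

lemma lorentz_commute: "lorentz u v = lorentz v u"
  by (simp add: lorentz_def inner_commute mult.commute)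

lemma bilinear_lorentz: "bilinear lorentz"
  unfolding bilinear_def by (intro conjI allI linearI) (simp_all add: lorentz_linear)

lemma lift_eq_scaleR: "x \<in> H3 \<Longrightarrow> \<exists>c>0. lift x = c *\<^sub>R (1, x)"
  unfolding lift_def mem_H3_iff by (intro exI[of _ "1 / sqrt (1 - x \<bullet> x)"]) auto

lemma lift_inj: "x \<in> H3 \<Longrightarrow> y \<in> H3 \<Longrightarrow> lift x = lift y \<Longrightarrow> x = y"
  using lift_eq_scaleR[of x] lift_eq_scaleR[of y] by fastforce

text \<open>The hyperboloid is not contained in a linear hyperplane; a linear map is therefore determined by
  its values on lifts, and a vector by its Lorentz products with lifts.\<close>

lemma span_lift_H3: "span (lift ` H3) = UNIV"
proof -
  have *: "(1, x) \<in> span (lift ` H3)" if x: "x \<in> H3" for x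
  proof -
    obtain c where c: "c > 0" "lift x = c *\<^sub>R (1, x)" using lift_eq_scaleR[OF x] by blast
    then have "(1, x) = (1 / c) *\<^sub>R lift x" by simp
    moreover have "(1 / c) *\<^sub>R lift x \<in> span (lift ` H3)"
      using x by (intro span_scale span_base) auto
    ultimately show ?thesis by simp
  qed
  have "(a, v) \<in> span (lift ` H3)" for a v
  proof -
    define k where "k = norm v + 1"
    have k: "k > 0" "(1 / k) *\<^sub>R v \<in> H3"
      by (auto simp: k_def divide_simps add_pos_nonneg add_nonneg_pos dist_norm)
    have "(a, v) = (a - k) *\<^sub>R (1, 0) + k *\<^sub>R (1, (1 / k) *\<^sub>R v)" using k by simp
    also have "\<dots> \<in> span (lift ` H3)"
      using *[of 0] *[OF k(2)] by (intro span_add span_scale) auto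
    finally show ?thesis .
  qed
  then show ?thesis by auto
qed

lemma lorentz_nondegenerate:
  assumes "\<And>x. x \<in> H3 \<Longrightarrow> lorentz u (lift x) = 0"
  shows "u = 0"
proof -
  have "lorentz u w = 0" for w
  proof -
    have "w \<in> span (lift ` H3)" by (simp add: span_lift_H3)
    then show ?thesis
      by (induction rule: span_induct_alt) (auto simp: lorentz_linear assms, simp add: lorentz_def)
  qed
  from this[of "(- fst u, snd u)"] have "snd u \<bullet> snd u + fst u * fst u = 0"
    by (simp add: lorentz_def)
  then show ?thesis
    by (metis add_nonneg_eq_0_iff inner_eq_zero_iff inner_ge_zero mult_eq_0_iff prod_eqI
        zero_le_square zero_prod_def fst_zero snd_zero)
qed

text \<open>For future timelike unit vectors the reverse Cauchy-Schwarz inequality holds.  It puts the argument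
  of \<open>arcosh\<close> in the distance into the range where \<open>arcosh\<close> is injective, so that isometries preserve the
  Lorentz products of lifts.\<close>

lemma lorentz_lift_le:
  assumes "x \<in> H3" "y \<in> H3"
  shows "- lorentz (lift x) (lift y) \<ge> 1"
proof -
  have 1: "x \<bullet> x < 1" "y \<bullet> y < 1" using assms unfolding mem_H3_iff by auto
  have le: "2 * (x \<bullet> y) \<le> x \<bullet> x + y \<bullet> y"
    using inner_ge_zero[of "x - y"] by (simp add: inner_simps inner_commute)
  \<comment> \<open>In terms of \<open>z\<close> the difference of the two sides is a sum of nonnegative terms.\<close>
  define z where "z = y - x"
  have y: "x \<bullet> y = x \<bullet> x + x \<bullet> z" "y \<bullet> y = x \<bullet> x + 2 * (x \<bullet> z) + z \<bullet> z"
    by (auto simp: z_def inner_simps inner_commute)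
  have "(1 - x \<bullet> y)\<^sup>2 - (1 - x \<bullet> x) * (1 - y \<bullet> y) = (1 - x \<bullet> x) * (z \<bullet> z) + (x \<bullet> z)\<^sup>2"
    unfolding y by (simp add: algebra_simps power2_eq_square)
  moreover have "\<dots> \<ge> 0" using 1 by simp
  ultimately have "(1 - x \<bullet> x) * (1 - y \<bullet> y) \<le> (1 - x \<bullet> y)\<^sup>2" by linarith
  moreover have "x \<bullet> y \<le> 1"
    using le 1 by linarith
  ultimately have "sqrt ((1 - x \<bullet> x) * (1 - y \<bullet> y)) \<le> 1 - x \<bullet> y"
    by (intro real_le_lsqrt) (auto intro: real_le_lsqrt)
  then have "sqrt (1 - x \<bullet> x) * sqrt (1 - y \<bullet> y) \<le> - lorentz (1, x) (1, y)"
    by (simp only: real_sqrt_mult) (simp add: lorentz_def)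
  then show ?thesis using 1
    by (simp add: lift_def lorentz_linear field_simps del: scaleR_Pair)
qed

lemma hyp_dist_lift: "x \<in> H3 \<Longrightarrow> y \<in> H3 \<Longrightarrow> hyp_dist x y = arcosh (- lorentz (lift x) (lift y))"
  by (simp add: hyp_dist_def lift_def lorentz_def diff_divide_distrib mult.commute)

definition lifts_to :: "(point \<Rightarrow> point) \<Rightarrow> (real \<times> point \<Rightarrow> real \<times> point) \<Rightarrow> bool" where
  "lifts_to f L \<longleftrightarrow> linear L \<and> (\<forall>u v. lorentz (L u) (L v) = lorentz u v) \<and>
     (\<forall>x\<in>H3. L (lift x) = lift (f x))"

text \<open>Extend the map \<open>lift x \<mapsto> lift (f x)\<close> linearly from a basis of lifts.  The vectors \<open>L (lift y)\<close> and
  \<open>lift (f y)\<close> then have the same Lorentz products with all \<open>lift (f z)\<close>, hence, as \<open>f\<close> is onto, with all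
  lifts, and nondegeneracy makes them equal.\<close>

lemma isometry_lifts:
  assumes bij: "bij_betw f H3 H3"
    and iso: "\<And>x y. x \<in> H3 \<Longrightarrow> y \<in> H3 \<Longrightarrow> hyp_dist (f x) (f y) = hyp_dist x y"
  obtains L where "lifts_to f L"
proof -
  have fH: "f x \<in> H3" if "x \<in> H3" for x using bij that by (auto simp: bij_betw_def)
  have pres: "lorentz (lift (f x)) (lift (f y)) = lorentz (lift x) (lift y)"
    if "x \<in> H3" "y \<in> H3" for x y
  proof -
    have "arcosh (- lorentz (lift (f x)) (lift (f y))) = arcosh (- lorentz (lift x) (lift y))"
      using iso[OF that] that fH by (simp add: hyp_dist_lift)
    then show ?thesis
      using lorentz_lift_le[OF that] lorentz_lift_le[OF fH fH, OF that]
        arcosh_less_iff_real[of "- lorentz (lift (f x)) (lift (f y))" "- lorentz (lift x) (lift y)"]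
        arcosh_less_iff_real[of "- lorentz (lift x) (lift y)" "- lorentz (lift (f x)) (lift (f y))"]
      by linarith
  qed
  obtain B where B: "B \<subseteq> lift ` H3" "independent B" "lift ` H3 \<subseteq> span B"
    using maximal_independent_subset by blast
  define \<phi> where "\<phi> b = lift (f (inv_into H3 lift b))" for b
  have \<phi>: "\<phi> (lift x) = lift (f x)" if "x \<in> H3" for x
    unfolding \<phi>_def by (metis f_inv_into_f imageI inv_into_into lift_inj that)
  obtain L where L: "linear L" "\<And>b. b \<in> B \<Longrightarrow> L b = \<phi> b"
    using linear_independent_extend[OF B(2)] by blast
  have sp: "lorentz (L w) (lift (f z)) = lorentz w (lift z)" if z: "z \<in> H3" for w z
  proof -
    have "w \<in> span B" using span_mono[OF B(3)] unfolding span_lift_H3 span_span by blast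
    then show ?thesis
    proof (induction rule: span_induct_alt)
      case base show ?case by (simp add: linear_0[OF L(1)], simp add: lorentz_def)
    next
      case (step c b y)
      obtain x where x: "x \<in> H3" "b = lift x" using B(1) step(1) by blast
      show ?case using step L(2)[OF step(1)] \<phi>[OF x(1)] x z pres
        by (simp add: linear_add[OF L(1)] linear_scale[OF L(1)] lorentz_linear)
    qed
  qed
  have lift: "L (lift x) = lift (f x)" if x: "x \<in> H3" for x
  proof -
    have "L (lift x) - lift (f x) = 0"
    proof (rule lorentz_nondegenerate)
      fix y assume "y \<in> H3"
      then obtain z where "z \<in> H3" "y = f z" using bij unfolding bij_betw_def by (metis imageE)
      then show "lorentz (L (lift x) - lift (f x)) (lift y) = 0"
        using sp[of z "lift x"] pres[OF x, of z] by (simp add: lorentz_linear)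
    qed
    then show ?thesis by simp
  qed
  have "lorentz (L u) (L v) = lorentz u v" for u v
  proof (rule bilinear_eq[of "\<lambda>u v. lorentz (L u) (L v)" lorentz UNIV "lift ` H3" UNIV "lift ` H3"])
    show "bilinear (\<lambda>u v. lorentz (L u) (L v))"
      unfolding bilinear_def
      by (intro conjI allI linearI)
        (simp_all add: lorentz_linear linear_add[OF L(1)] linear_scale[OF L(1)])
  qed (auto simp: bilinear_lorentz span_lift_H3 lift pres)
  with L(1) lift show ?thesis by (intro that[of L]) (auto simp: lifts_to_def)
qed

lemma lifts_to_D:
  assumes "lifts_to f L"
  shows "linear L" "lorentz (L u) (L v) = lorentz u v" "x \<in> H3 \<Longrightarrow> L (lift x) = lift (f x)"
  using assms unfolding lifts_to_def by blast+

lemma lifts_to_projective: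
  assumes "lifts_to f L" "x \<in> H3" "f x \<in> H3"
  obtains c where "c > 0" "L (1, x) = c *\<^sub>R (1, f x)"
proof -
  obtain a b where a: "a > 0" "lift x = a *\<^sub>R (1, x)" and b: "b > 0" "lift (f x) = b *\<^sub>R (1, f x)"
    using lift_eq_scaleR assms(2,3) by meson
  have "L (1, x) = (1 / a) *\<^sub>R L (lift x)"
    using a linear_scale[OF lifts_to_D(1)[OF assms(1)], of a "(1,x)"] by simp
  also have "\<dots> = (b / a) *\<^sub>R (1, f x)" using lifts_to_D(3)[OF assms(1,2)] b by simp
  finally show ?thesis using a b by (intro that[of "b / a"]) auto
qed

text \<open>The vector \<open>L (1, x)\<close> is in general only a positive multiple of \<open>(1, f x)\<close>; at a fixed point the multiple is
  1 because \<open>L\<close> maps the hyperboloid to itself.\<close>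

lemma lifts_to_fixed:
  assumes "lifts_to f L" "x \<in> H3" "f x \<in> H3"
  shows "f x = x \<longleftrightarrow> L (1, x) = (1, x)"
proof -
  obtain a where a: "a > 0" "lift x = a *\<^sub>R (1, x)" using lift_eq_scaleR assms(2) by meson
  have "L (lift x) = a *\<^sub>R L (1, x)"
    using a linear_scale[OF lifts_to_D(1)[OF assms(1)], of a "(1,x)"] by simp
  then have *: "lift (f x) = a *\<^sub>R L (1, x)" using lifts_to_D(3)[OF assms(1,2)] by simp
  show ?thesis
  proof
    assume "f x = x" then show "L (1, x) = (1, x)" using * a by (metis less_irrefl scaleR_cancel_left)
  next
    assume "L (1, x) = (1, x)"
    then have "lift (f x) = lift x" using * a by simp
    then show "f x = x" using lift_inj assms(2,3) by blast
  qed
qed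

text \<open>The lifts of the orbit of the origin add up to an invariant timelike vector.  The ray that it spans
  meets the ball in a fixed point.\<close>

lemma finite_order_imp_fixed_point:
  assumes L: "lifts_to f L" and fH: "\<And>x. x \<in> H3 \<Longrightarrow> f x \<in> H3"
    and n: "n > 0" and per: "\<And>x. x \<in> H3 \<Longrightarrow> (f ^^ n) x = x"
  obtains x where "x \<in> H3" "f x = x"
proof -
  define F where "F k = lift ((f ^^ k) 0)" for k
  have orb: "(f ^^ k) 0 \<in> H3" for k by (induction k) (use fH in auto)
  have LF: "L (F k) = F (Suc k)" for k unfolding F_def using lifts_to_D(3)[OF L orb] by simp
  define w where "w = (\<Sum>k<n. F k)"
  have "L w = (\<Sum>k<n. F (Suc k))" unfolding w_def by (simp add: linear_sum[OF lifts_to_D(1)[OF L]] LF)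
  also have "\<dots> = w"
    using sum.lessThan_Suc_shift[of F n] sum.lessThan_Suc[of F n] per[of 0]
    by (simp add: w_def F_def)
  finally have Lw: "L w = w" .
  have Fpos: "norm (snd (F k)) < fst (F k)" for k
  proof -
    obtain c where "c > 0" "F k = c *\<^sub>R (1, (f ^^ k) 0)"
      unfolding F_def using lift_eq_scaleR[OF orb] by blast
    then show ?thesis using orb[of k] by simp
  qed
  have "norm (snd w) \<le> (\<Sum>k<n. norm (snd (F k)))" by (simp add: w_def snd_sum norm_sum)
  also have "\<dots> < (\<Sum>k<n. fst (F k))" using n Fpos by (intro sum_strict_mono) auto
  finally have less: "norm (snd w) < fst w" by (simp add: w_def fst_sum)
  then have pos: "fst w > 0" using norm_ge_zero[of "snd w"] by linarith
  define x where "x = (1 / fst w) *\<^sub>R snd w"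
  have x: "x \<in> H3" using less pos by (simp add: x_def divide_simps)
  have "w = fst w *\<^sub>R (1, x)" using pos by (simp add: x_def prod_eq_iff)
  then have "fst w *\<^sub>R L (1, x) = fst w *\<^sub>R (1, x)"
    using Lw linear_scale[OF lifts_to_D(1)[OF L], of "fst w" "(1, x)"] by simp
  then have "L (1, x) = (1, x)" using pos by (metis less_irrefl scaleR_cancel_left)
  then show ?thesis using x fH lifts_to_fixed[OF L x] that by blast
qed

lemma open_segment_subset_H3: "a \<in> H3 \<Longrightarrow> b \<in> H3 \<Longrightarrow> open_segment a b \<subseteq> H3"
  using convex_ball[of "0::point" 1] unfolding convex_contains_open_segment by blast

lemma lorentz_timelike: "x \<in> H3 \<Longrightarrow> lorentz (1, x) (1, x) < 0"
  unfolding mem_H3_iff by (simp add: lorentz_def)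

lemma lifts_to_apply:
  assumes "lifts_to f L" "x \<in> H3" "f x \<in> H3"
  shows "fst (L (1, x)) > 0" "f x = (1 / fst (L (1, x))) *\<^sub>R snd (L (1, x))"
proof -
  obtain c where "c > 0" "L (1, x) = c *\<^sub>R (1, f x)"
    using lifts_to_projective[OF assms] .
  then show "fst (L (1, x)) > 0" "f x = (1 / fst (L (1, x))) *\<^sub>R snd (L (1, x))" by auto
qed

lemma lifts_to_has_derivative:
  assumes L: "lifts_to f L" and fH: "\<And>y. y \<in> H3 \<Longrightarrow> f y \<in> H3" and x: "x \<in> H3" "f x = x"
  shows "(f has_derivative (\<lambda>v. snd (L (0, v)) - fst (L (0, v)) *\<^sub>R x)) (at x)"
proof -
  have lin: "linear L" using lifts_to_D(1)[OF L] .
  have bl: "bounded_linear L" using lin by (simp add: linear_linear)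
  have Lx: "L (1, x) = (1, x)" using lifts_to_fixed[OF L x(1)] x by simp
  have d: "((\<lambda>y. L (1, y)) has_derivative (\<lambda>v. L (0, v))) (at x)"
    by (rule bounded_linear.has_derivative[OF bl]) (auto intro!: derivative_eq_intros)
  have d1: "((\<lambda>y. fst (L (1, y))) has_derivative (\<lambda>v. fst (L (0, v)))) (at x)"
    by (rule has_derivative_fst[OF d])
  have d2: "((\<lambda>y. snd (L (1, y))) has_derivative (\<lambda>v. snd (L (0, v)))) (at x)"
    by (rule has_derivative_snd[OF d])
  have "((\<lambda>y. (inverse (fst (L (1, y)))) *\<^sub>R snd (L (1, y))) has_derivative
      (\<lambda>v. snd (L (0, v)) - fst (L (0, v)) *\<^sub>R x)) (at x)"
    by (rule has_derivative_eq_rhs[OF has_derivative_scaleR[OF Deriv.has_derivative_inverse[OF _ d1] d2]])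
      (auto simp: Lx fun_eq_iff)
  then show ?thesis
  proof (rule has_derivative_transform_within_open[OF _ _ x(1)])
    fix y assume y: "y \<in> H3"
    show "inverse (fst (L (1, y))) *\<^sub>R snd (L (1, y)) = f y"
      using lifts_to_apply(2)[OF L y fH[OF y]] by (simp add: inverse_eq_divide)
  qed simp
qed

text \<open>From \<open>A\<^sup>T B A = B\<close> one gets \<open>A\<^sup>T B (A - 1) = - (A\<^sup>T - 1) B\<close>.  As the dimension is odd, taking
  determinants gives \<open>det B * det (A - 1) * (det A + 1) = 0\<close>, so 1 is an eigenvalue of \<open>A\<close>.\<close>

lemma det_pos_preserving_form_fixes_vector:
  fixes A B :: "real^3^3"
  assumes form: "transpose A ** B ** A = B" and B: "det B \<noteq> 0" and A: "det A > 0"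
  obtains v where "v \<noteq> 0" "A *v v = v"
proof -
  let ?I = "mat 1 :: real^3^3"
  have neg: "det (- M) = - det M" for M :: "real^3^3" by (simp add: det_3)
  have "transpose A ** B ** (A - ?I) = - (transpose (A - ?I) ** B)"
  proof -
    have 1: "transpose A ** B ** (A - ?I) + transpose A ** B = B"
      using matrix_add_ldistrib[of "transpose A ** B" "A - ?I" ?I] form by simp
    have 2: "transpose (A - ?I) = transpose A - ?I"
      by (simp add: transpose_def mat_def vec_eq_iff)
    have 3: "(transpose A - ?I) ** B + B = transpose A ** B"
      by (simp add: matrix_eq matrix_vector_mult_add_rdistrib
          matrix_vector_mult_diff_rdistrib matrix_vector_mul_assoc[symmetric])
    have "transpose A ** B ** (A - ?I) + ((transpose A - ?I) ** B + B) = B"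
      using 1 by (simp only: 3)
    then have "transpose A ** B ** (A - ?I) + (transpose A - ?I) ** B = 0"
      by (simp only: add.assoc[symmetric] add_cancel_left_left)
    then show ?thesis unfolding 2 by (simp only: eq_neg_iff_add_eq_0)
  qed
  from arg_cong[where f = det, OF this]
  have "det A * det B * det (A - ?I) = - (det (A - ?I) * det B)"
    by (simp only: det_mul det_transpose neg)
  then have "det B * det (A - ?I) * (det A + 1) = 0" by (simp add: algebra_simps)
  then have "det (A - ?I) = 0" using A B by auto
  then have "\<not> invertible (A - ?I)" by (simp add: invertible_det_nz)
  then obtain v where "(A - ?I) *v v = 0" "v \<noteq> 0"
    by (metis invertible_left_inverse matrix_left_invertible_ker)
  then show ?thesis by (intro that[of v]) (auto simp: matrix_vector_mult_diff_rdistrib)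
qed

text \<open>The tangent space at \<open>x\<close> is the Lorentz complement of \<open>(1, x)\<close>.  In the affine chart its inner
  product is a positive definite form, which the derivative of an isometry fixing \<open>x\<close> preserves; the
  derivative therefore fixes a nonzero vector \<open>v\<close>.  The lift fixes \<open>(0, v)\<close> up to a multiple of \<open>(1, x)\<close>,
  and this multiple vanishes because the product with the fixed vector \<open>(1, x)\<close> is preserved.  So the
  whole line through \<open>x\<close> in direction \<open>v\<close> is fixed.\<close>

lemma orientation_preserving_fixed_point_imp_axis:
  assumes f: "f \<in> orientation_preserving_isometries" and L: "lifts_to f L"
    and x: "x \<in> H3" "f x = x"
  obtains v where "v \<noteq> 0" "\<And>t. L (1, x + t *\<^sub>R v) = (1, x + t *\<^sub>R v)"
proof -
  have fH: "f y \<in> H3" if "y \<in> H3" for y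
    using f that by (auto simp: orientation_preserving_isometries_def Bij_def bij_betw_def)
  have lin: "linear L" and pres: "\<And>u v. lorentz (L u) (L v) = lorentz u v"
    using lifts_to_D[OF L] by auto
  have Lx: "L (1, x) = (1, x)" using lifts_to_fixed[OF L x(1)] x by simp
  have xx: "x \<bullet> x < 1" using x(1) unfolding mem_H3_iff .
  define f' where "f' v = snd (L (0, v)) - fst (L (0, v)) *\<^sub>R x" for v
  have der: "(f has_derivative f') (at x)"
    using lifts_to_has_derivative[OF L fH x] unfolding f'_def .
  obtain f'' where "(f has_derivative f'') (at x)" "det (matrix f'') > 0"
    using f x(1) unfolding orientation_preserving_isometries_def by blast
  then have det: "det (matrix f') > 0" using der has_derivative_unique by blast
  have linf: "linear f'" using der has_derivative_linear by blast
  define c where "c = 1 / (1 - x \<bullet> x)"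
  have c: "c > 0" "c * (1 - x \<bullet> x) = 1" using xx by (auto simp: c_def)
  \<comment> \<open>The projection of \<open>(0, v)\<close> to the tangent space along \<open>(1, x)\<close>.\<close>
  define \<pi> where "\<pi> v = (0::real, v) + (c * (v \<bullet> x)) *\<^sub>R (1, x)" for v
  have \<pi>x: "lorentz (\<pi> v) (1, x) = 0" for v
  proof -
    have "lorentz (\<pi> v) (1, x) = (v \<bullet> x) - (v \<bullet> x) * (c * (1 - x \<bullet> x))"
      unfolding \<pi>_def lorentz_linear by (simp add: lorentz_def algebra_simps)
    then show ?thesis using c by simp
  qed
  define b where "b u v = u \<bullet> v + c * (u \<bullet> x) * (v \<bullet> x)" for u v
  have b: "lorentz (\<pi> u) (\<pi> v) = b u v" for u v
  proof -
    have "lorentz (\<pi> u) (\<pi> v) = lorentz (\<pi> u) (0, v) + (c * (v \<bullet> x)) * lorentz (\<pi> u) (1, x)"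
      by (simp only: \<pi>_def[of v] lorentz_add_right lorentz_scaleR_right)
    then have "lorentz (\<pi> u) (\<pi> v) = lorentz (\<pi> u) (0, v)" by (simp only: \<pi>x mult_zero_right add_0_right)
    also have "\<dots> = b u v"
      unfolding \<pi>_def lorentz_linear b_def by (simp add: lorentz_def inner_commute)
    finally show ?thesis .
  qed
  have L0: "L (0, v) = (0, f' v) + fst (L (0, v)) *\<^sub>R (1, x)" for v
    by (simp add: f'_def prod_eq_iff)
  have L\<pi>: "L (\<pi> v) = \<pi> (f' v)" for v
  proof -
    have *: "L (\<pi> v) = (0, f' v) + (fst (L (0, v)) + c * (v \<bullet> x)) *\<^sub>R (1, x)"
      unfolding \<pi>_def linear_add[OF lin] linear_scale[OF lin] Lx
      by (subst L0) (simp add: scaleR_add_left)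
    define s where "s = fst (L (0, v)) + c * (v \<bullet> x)"
    have "lorentz (L (\<pi> v)) (1, x) = 0" using pres[of "\<pi> v" "(1, x)"] \<pi>x Lx by simp
    then have "(f' v \<bullet> x) + s * (x \<bullet> x - 1) = 0"
      unfolding * s_def[symmetric] lorentz_linear by (simp add: lorentz_def)
    then have s: "s = c * (f' v \<bullet> x)" using xx unfolding c_def by (simp add: field_simps)
    have "\<pi> (f' v) = (0, f' v) + s *\<^sub>R (1, x)" by (simp only: \<pi>_def s)
    then show ?thesis using * by (simp only: s_def)
  qed
  have bpres: "b (f' u) (f' v) = b u v" for u v
    using b[of "f' u" "f' v"] b[of u v] pres[of "\<pi> u" "\<pi> v"] L\<pi> by simp
  \<comment> \<open>The symmetric operator that represents the form \<open>b\<close>.\<close>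
  define \<beta> where "\<beta> v = v + (c * (v \<bullet> x)) *\<^sub>R x" for v
  have lin\<beta>: "linear \<beta>"
    unfolding \<beta>_def by (rule linearI) (simp_all add: inner_simps algebra_simps)
  have b\<beta>: "b u v = u \<bullet> \<beta> v" for u v by (simp add: b_def \<beta>_def inner_simps algebra_simps)
  let ?A = "matrix f'" and ?B = "matrix \<beta>"
  have Av: "?A *v v = f' v" and Bv: "?B *v v = \<beta> v" for v
    using matrix_vector_mul(2)[OF linf] matrix_vector_mul(2)[OF lin\<beta>] by (auto dest: fun_cong)
  have "(transpose ?A ** ?B ** ?A) *v v = ?B *v v" for v
  proof (rule vector_eq_rdot[THEN iffD1], intro allI)
    fix u
    have "u \<bullet> ((transpose ?A ** ?B ** ?A) *v v) = u \<bullet> (transpose ?A *v (?B *v (?A *v v)))"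
      by (simp only: matrix_vector_mul_assoc matrix_mul_assoc)
    also have "\<dots> = (?A *v u) \<bullet> (?B *v (?A *v v))"
      using dot_lmul_matrix[of u "transpose ?A"] by (simp only: vector_transpose_matrix)
    also have "\<dots> = b u v" using bpres b\<beta> by (simp add: Av Bv)
    finally show "((transpose ?A ** ?B ** ?A) *v v) \<bullet> u = (?B *v v) \<bullet> u"
      by (simp add: b\<beta> Bv inner_commute)
  qed
  then have form: "transpose ?A ** ?B ** ?A = ?B" by (simp add: matrix_eq)
  have "det ?B \<noteq> 0"
  proof -
    have "v = 0" if "?B *v v = 0" for v
    proof -
      have "b v v = 0" using that b\<beta>[of v v] by (simp add: Bv)
      moreover have "b v v \<ge> v \<bullet> v" using c by (simp add: b_def mult.assoc)
      ultimately have "v \<bullet> v \<le> 0" by simp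
      then show ?thesis by (metis inner_eq_zero_iff inner_ge_zero antisym)
    qed
    then show ?thesis
      by (metis invertible_det_nz invertible_left_inverse matrix_left_invertible_ker)
  qed
  from det_pos_preserving_form_fixes_vector[OF form this det]
  obtain v where v: "v \<noteq> 0" "f' v = v" unfolding Av by blast
  define s where "s = fst (L (0, v))"
  have Lv: "L (0, v) = (0, v) + s *\<^sub>R (1, x)" using L0[of v] v(2) by (simp only: s_def)
  have "lorentz (L (0, v)) (1, x) = lorentz (0, v) (1, x)" using pres[of "(0, v)" "(1, x)"] Lx by simp
  then have "s * lorentz (1, x) (1, x) = 0"
    by (simp only: Lv lorentz_add_left lorentz_scaleR_left add_cancel_left_right)
  then have "s = 0" using lorentz_timelike[OF x(1)] by auto
  then have Lv: "L (0, v) = (0, v)" using Lv by simp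
  have "L (1, x + t *\<^sub>R v) = (1, x + t *\<^sub>R v)" for t
    using linear_add[OF lin, of "(1, x)" "t *\<^sub>R (0, v)"] linear_scale[OF lin, of t "(0, v)"] Lx Lv
    by simp
  with v(1) show ?thesis by (rule that)
qed

section \<open>Groups of isometries\<close>

locale kleinian =
  fixes G :: "(point \<Rightarrow> point) set"
  assumes kleinian: "kleinian_group G"
begin

abbreviation inverse_map :: "(point \<Rightarrow> point) \<Rightarrow> point \<Rightarrow> point" where
  "inverse_map h \<equiv> inv\<^bsub>BijGroup H3\<^esub> h"

lemma subgroup: "subgroup G (BijGroup H3)"
  using kleinian by (simp add: kleinian_group_def)

lemma isometry: "h \<in> G \<Longrightarrow> h \<in> orientation_preserving_isometries"
  using kleinian by (auto simp: kleinian_group_def)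

lemma Bij: "h \<in> G \<Longrightarrow> h \<in> Bij H3"
  using isometry unfolding orientation_preserving_isometries_def by blast

lemma bij: "h \<in> G \<Longrightarrow> bij_betw h H3 H3"
  using Bij unfolding Bij_def by blast

lemma maps_H3: "h \<in> G \<Longrightarrow> x \<in> H3 \<Longrightarrow> h x \<in> H3"
  using bij unfolding bij_betw_def by (metis imageI)

lemma inj_H3: "h \<in> G \<Longrightarrow> x \<in> H3 \<Longrightarrow> y \<in> H3 \<Longrightarrow> h x = h y \<Longrightarrow> x = y"
  using bij unfolding bij_betw_def by (metis inj_onD)

lemma one_apply: "x \<in> H3 \<Longrightarrow> \<one>\<^bsub>BijGroup H3\<^esub> x = x"
  by (simp add: BijGroup_def)

lemma one_in: "\<one>\<^bsub>BijGroup H3\<^esub> \<in> G"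
  using subgroup by (rule subgroup.one_closed)

lemma mult_in: "h \<in> G \<Longrightarrow> k \<in> G \<Longrightarrow> h \<otimes>\<^bsub>BijGroup H3\<^esub> k \<in> G"
  using subgroup by (rule subgroup.m_closed)

lemma mult_apply: "h \<in> G \<Longrightarrow> k \<in> G \<Longrightarrow> x \<in> H3 \<Longrightarrow> (h \<otimes>\<^bsub>BijGroup H3\<^esub> k) x = h (k x)"
  using Bij by (simp add: BijGroup_def compose_def)

lemma inverse_in: "h \<in> G \<Longrightarrow> inverse_map h \<in> G"
  using subgroup by (rule subgroup.m_inv_closed)

lemma inverse_left: "h \<in> G \<Longrightarrow> x \<in> H3 \<Longrightarrow> inverse_map h (h x) = x"
  using Bij[of h] bij[of h] maps_H3[of h x] unfolding bij_betw_def
  by (simp add: inv_BijGroup inv_into_f_f del: mem_ball_0)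

lemma inverse_right: "h \<in> G \<Longrightarrow> x \<in> H3 \<Longrightarrow> h (inverse_map h x) = x"
  using Bij[of h] bij[of h] unfolding bij_betw_def
  by (simp add: inv_BijGroup f_inv_into_f del: mem_ball_0)

lemma eqI: "h \<in> G \<Longrightarrow> k \<in> G \<Longrightarrow> (\<And>x. x \<in> H3 \<Longrightarrow> h x = k x) \<Longrightarrow> h = k"
  using Bij[of h] Bij[of k] by (intro extensionalityI[of h H3 k]) (auto simp: Bij_def)

lemma obtain_lift:
  assumes "h \<in> G"
  obtains L where "lifts_to h L"
proof -
  have "hyp_dist (h x) (h y) = hyp_dist x y" if "x \<in> H3" "y \<in> H3" for x y
    using isometry[OF assms] that unfolding orientation_preserving_isometries_def by blast
  from isometry_lifts[OF bij[OF assms] this] that show ?thesis by metis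
qed

lemma continuous: "h \<in> G \<Longrightarrow> continuous_on H3 h"
proof (intro continuous_at_imp_continuous_on ballI)
  fix x assume "h \<in> G" "x \<in> H3"
  then obtain h' where "(h has_derivative h') (at x)"
    using isometry unfolding orientation_preserving_isometries_def by blast
  then show "isCont h x" by (rule has_derivative_continuous)
qed

lemma image_eq_vimage: "h \<in> G \<Longrightarrow> S \<subseteq> H3 \<Longrightarrow> h ` S = H3 \<inter> inverse_map h -` S"
proof
  assume h: "h \<in> G" and S: "S \<subseteq> H3"
  show "h ` S \<subseteq> H3 \<inter> inverse_map h -` S"
    using maps_H3[OF h] inverse_left[OF h] S by (auto simp del: mem_ball_0 simp: subset_iff)
  show "H3 \<inter> inverse_map h -` S \<subseteq> h ` S"
  proof
    fix y assume "y \<in> H3 \<inter> inverse_map h -` S"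
    then have "inverse_map h y \<in> S" "h (inverse_map h y) = y" using inverse_right[OF h] by blast+
    then show "y \<in> h ` S" by (metis imageI)
  qed
qed

lemma open_image: "h \<in> G \<Longrightarrow> S \<subseteq> H3 \<Longrightarrow> open S \<Longrightarrow> open (h ` S)"
  using continuous_open_preimage[OF continuous[OF inverse_in[of h]] open_ball, of S]
  by (simp add: image_eq_vimage del: mem_ball_0)

lemma image_interior: "h \<in> G \<Longrightarrow> S \<subseteq> H3 \<Longrightarrow> h ` interior S \<subseteq> interior (h ` S)"
  using open_image[of h "interior S"] interior_subset[of S]
  by (intro interior_maximal image_mono) auto

text \<open>Lorentz maps are linear, so isometries map lines to lines and preserve betweenness on them.\<close>

lemma image_affine_combination:
  assumes h: "h \<in> G" and a: "a \<in> H3" and b: "b \<in> H3" and z: "z \<in> H3" "z = (1 - t) *\<^sub>R a + t *\<^sub>R b"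
  obtains s where "h z = (1 - s) *\<^sub>R h a + s *\<^sub>R h b" "0 < t \<Longrightarrow> t < 1 \<Longrightarrow> 0 < s \<and> s < 1"
proof -
  obtain L where L: "lifts_to h L" using obtain_lift[OF h] .
  have lin: "linear L" using lifts_to_D(1)[OF L] .
  obtain p where p: "p > 0" "L (1, a) = p *\<^sub>R (1, h a)"
    using lifts_to_projective[OF L a maps_H3[OF h a]] .
  obtain q where q: "q > 0" "L (1, b) = q *\<^sub>R (1, h b)"
    using lifts_to_projective[OF L b maps_H3[OF h b]] .
  obtain r where r: "r > 0" "L (1, z) = r *\<^sub>R (1, h z)"
    using lifts_to_projective[OF L z(1) maps_H3[OF h z(1)]] .
  have "(1, z) = (1 - t) *\<^sub>R (1, a) + t *\<^sub>R (1, b)" using z(2) by simp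
  then have "L (1, z) = (1 - t) *\<^sub>R L (1, a) + t *\<^sub>R L (1, b)"
    by (metis linear_add[OF lin] linear_scale[OF lin])
  then have e: "r = (1 - t) * p + t * q" "r *\<^sub>R h z = ((1 - t) * p) *\<^sub>R h a + (t * q) *\<^sub>R h b"
    unfolding p q r by auto
  define s where "s = t * q / r"
  have s: "1 - s = (1 - t) * p / r" using r(1) e(1) by (simp add: s_def field_simps)
  have "h z = (1 / r) *\<^sub>R (r *\<^sub>R h z)" using r(1) by simp
  also have "\<dots> = (1 - s) *\<^sub>R h a + s *\<^sub>R h b"
    unfolding e(2) s by (simp add: s_def scaleR_add_right)
  finally have hz: "h z = (1 - s) *\<^sub>R h a + s *\<^sub>R h b" .
  have "0 < s \<and> s < 1" if t: "0 < t" "t < 1"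
  proof -
    have "s > 0" "1 - s > 0" unfolding s unfolding s_def using t p(1) q(1) r(1) by auto
    then show ?thesis by simp
  qed
  with hz show ?thesis by (rule that)
qed

lemma image_open_segment:
  assumes h: "h \<in> G" and a: "a \<in> H3" and b: "b \<in> H3" and z: "z \<in> open_segment a b"
  shows "h z \<in> open_segment (h a) (h b)"
proof -
  have zH: "z \<in> H3"
    using z open_segment_subset_H3[OF a b] by blast
  obtain t where t: "a \<noteq> b" "0 < t" "t < 1" "z = (1 - t) *\<^sub>R a + t *\<^sub>R b"
    using z by (auto simp: in_segment)
  obtain s where "h z = (1 - s) *\<^sub>R h a + s *\<^sub>R h b" "0 < s \<and> s < 1"
    using image_affine_combination[OF h a b zH t(4)] t by metis
  moreover have "h a \<noteq> h b" using t(1) inj_H3[OF h a b] by blast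
  ultimately show ?thesis by (auto simp: in_segment)
qed

lemma image_open_segment_iff:
  assumes h: "h \<in> G" and a: "a \<in> H3" and b: "b \<in> H3" and z: "z \<in> H3"
  shows "h z \<in> open_segment (h a) (h b) \<longleftrightarrow> z \<in> open_segment a b"
  using image_open_segment[OF h a b]
    image_open_segment[OF inverse_in[OF h] maps_H3[OF h a] maps_H3[OF h b], of "h z"]
    inverse_left[OF h a] inverse_left[OF h b] inverse_left[OF h z] by auto

lemma image_affine_hull_2:
  assumes h: "h \<in> G" and a: "a \<in> H3" and b: "b \<in> H3" and z: "z \<in> H3" "z \<in> affine hull {a, b}"
  shows "h z \<in> affine hull {h a, h b}"
proof -
  obtain u t where "u + t = 1" "z = u *\<^sub>R a + t *\<^sub>R b" using z(2) unfolding affine_hull_2 by blast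
  then have "z = (1 - t) *\<^sub>R a + t *\<^sub>R b" by (metis add_diff_cancel_right')
  from image_affine_combination[OF h a b z(1) this]
  obtain s where "h z = (1 - s) *\<^sub>R h a + s *\<^sub>R h b" by metis
  then show ?thesis unfolding affine_hull_2 by (intro CollectI exI[of _ "1 - s"] exI[of _ s]) simp
qed

text \<open>Pull a segment between image points back by the inverse isometry.\<close>

lemma convex_image:
  assumes h: "h \<in> G" and S: "S \<subseteq> H3" "convex S"
  shows "convex (h ` S)"
  unfolding convex_contains_open_segment
proof clarify
  fix a b z assume ab: "a \<in> S" "b \<in> S" and z: "z \<in> open_segment (h a) (h b)"
  have H: "h a \<in> H3" "h b \<in> H3" "a \<in> H3" "b \<in> H3" using ab S maps_H3[OF h] by blast+
  have zH: "z \<in> H3"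
    using z open_segment_subset_H3[OF H(1,2)] by blast
  define y where "y = inverse_map h z"
  have y: "z = h y" "y \<in> H3"
    using inverse_right[OF h zH] maps_H3[OF inverse_in[OF h] zH] by (auto simp: y_def)
  then have "y \<in> open_segment a b" using image_open_segment_iff[OF h H(3,4) y(2)] z by simp
  then have "y \<in> S" using S(2) ab unfolding convex_contains_open_segment by blast
  then show "z \<in> h ` S" using y by blast
qed

lemma face_of_image:
  assumes h: "h \<in> G" and S: "S \<subseteq> H3" and F: "F face_of S"
  shows "h ` F face_of h ` S"
  unfolding face_of_def
proof (intro conjI ballI impI)
  have FS: "F \<subseteq> S" using F face_of_imp_subset by blast
  show "h ` F \<subseteq> h ` S" using FS by blast
  show "convex (h ` F)" using FS S F face_of_imp_convex by (intro convex_image[OF h]) auto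
  fix a b x assume "a \<in> h ` S" "b \<in> h ` S" "x \<in> h ` F" and seg: "x \<in> open_segment a b"
  then obtain a' b' x' where *: "a = h a'" "b = h b'" "x = h x'" "a' \<in> S" "b' \<in> S" "x' \<in> F" by blast
  then have "x' \<in> open_segment a' b'"
    using seg image_open_segment_iff[OF h, of a' b' x'] S FS by blast
  then have "a' \<in> F" "b' \<in> F" using F * unfolding face_of_def by blast+
  then show "a \<in> h ` F" "b \<in> h ` F" using * by auto
qed

end

section \<open>Local structure of a convex polyhedron\<close>

lemma small_step:
  fixes x u :: "'a::real_normed_vector"
  assumes "r > 0"
  obtains t where "t > 0" "t \<le> 1" "\<And>s. \<bar>s\<bar> \<le> t \<Longrightarrow> x + s *\<^sub>R u \<in> ball x r"
proof
  have pos: "2 * (norm u + 1) > 0" using add_nonneg_pos[OF norm_ge_zero[of u] zero_less_one] by simp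
  define t where "t = min 1 (r / (2 * (norm u + 1)))"
  show "t > 0" "t \<le> 1" using assms pos by (simp_all add: t_def)
  fix s assume "\<bar>s\<bar> \<le> t"
  then have "\<bar>s\<bar> \<le> r / (2 * (norm u + 1))" by (simp add: t_def)
  then have "\<bar>s\<bar> * (2 * (norm u + 1)) \<le> r" by (simp only: pos_le_divide_eq[OF pos])
  then have "\<bar>s\<bar> * (norm u + 1) \<le> r / 2" by (simp add: algebra_simps)
  then have "\<bar>s\<bar> * norm u < r"
    using assms abs_ge_zero[of s] by (simp add: distrib_left)
  then show "x + s *\<^sub>R u \<in> ball x r" by (simp add: dist_norm)
qed

lemma convex_step:
  assumes "convex S" "x \<in> S" "z \<in> S" "0 \<le> t" "t \<le> 1"
  shows "x + t *\<^sub>R (z - x) \<in> S"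
proof -
  have "(1 - t) *\<^sub>R x + t *\<^sub>R z \<in> S" using assms by (intro convexD_alt) auto
  then show ?thesis by (simp add: algebra_simps)
qed

lemma orthogonal_to_basis_imp_0:
  fixes d v w m :: point
  assumes ind: "\<And>p q r. p *\<^sub>R d + q *\<^sub>R v + r *\<^sub>R w = 0 \<Longrightarrow> p = 0 \<and> q = 0 \<and> r = 0"
    and m: "m \<bullet> d = 0" "m \<bullet> v = 0" "m \<bullet> w = 0"
  shows "m = 0"
proof -
  define A :: "real^3^3" where "A = vector [d, v, w]"
  have "c = 0" if "transpose A *v c = 0" for c
  proof -
    have "c $ 1 *\<^sub>R d + c $ 2 *\<^sub>R v + c $ 3 *\<^sub>R w = 0"
      using that by (simp add: A_def vec_eq_iff matrix_vector_mult_def transpose_def sum_3 forall_3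
          mult.commute)
    from ind[OF this] show ?thesis by (simp add: vec_eq_iff forall_3)
  qed
  then have "invertible (transpose A)"
    by (metis invertible_left_inverse matrix_left_invertible_ker)
  then have inv: "invertible A" by (metis invertible_det_nz det_transpose)
  have "A *v m = 0"
    using m by (simp add: A_def vec_eq_iff matrix_vector_mult_def forall_3 inner_vec_def sum_3
        mult.commute)
  then show ?thesis using inv by (metis invertible_left_inverse matrix_left_invertible_ker)
qed

text \<open>In the directions around a line through \<open>x\<close> with direction \<open>d\<close>, a convex polyhedron that contains a
  piece of the line on both sides of \<open>x\<close> looks like a sector of the plane.  Either the sector is the
  whole plane, or it is a half-plane, or it is properly bounded by two walls with normals \<open>b\<close> and \<open>c\<close>.  In
  the last case each wall must contain directions strictly inside the other half-space; \<open>v\<close> and \<open>w\<close>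
  are such directions.\<close>

definition locally_halfspace :: "point set \<Rightarrow> point \<Rightarrow> point \<Rightarrow> bool" where
  "locally_halfspace P x b \<longleftrightarrow> b \<noteq> 0 \<and>
     (\<exists>r>0. ball x r \<subseteq> H3 \<and> P \<inter> ball x r = {z \<in> ball x r. b \<bullet> (z - x) \<le> 0})"

definition locally_wedge :: "point set \<Rightarrow> point \<Rightarrow> point \<Rightarrow> point \<Rightarrow> point \<Rightarrow> bool" where
  "locally_wedge P x d b c \<longleftrightarrow> b \<bullet> d = 0 \<and> c \<bullet> d = 0 \<and>
     (\<exists>v w. b \<bullet> v = 0 \<and> c \<bullet> v < 0 \<and> c \<bullet> w = 0 \<and> b \<bullet> w < 0) \<and>
     (\<exists>r>0. ball x r \<subseteq> H3 \<and>
        P \<inter> ball x r = {z \<in> ball x r. b \<bullet> (z - x) \<le> 0 \<and> c \<bullet> (z - x) \<le> 0})"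

lemma locally_wedge_commute: "locally_wedge P x d b c \<Longrightarrow> locally_wedge P x d c b"
  unfolding locally_wedge_def
proof (elim conjE exE, intro conjI)
  fix v w r
  assume vw: "b \<bullet> v = 0" "c \<bullet> v < 0" "c \<bullet> w = 0" "b \<bullet> w < 0"
    and r: "r > 0" "ball x r \<subseteq> H3"
      "P \<inter> ball x r = {z \<in> ball x r. b \<bullet> (z - x) \<le> 0 \<and> c \<bullet> (z - x) \<le> 0}"
  show "\<exists>v w. c \<bullet> v = 0 \<and> b \<bullet> v < 0 \<and> b \<bullet> w = 0 \<and> c \<bullet> w < 0"
    using vw by (intro exI[of _ w] exI[of _ v]) simp
  show "\<exists>r>0. ball x r \<subseteq> H3 \<and>
      P \<inter> ball x r = {z \<in> ball x r. c \<bullet> (z - x) \<le> 0 \<and> b \<bullet> (z - x) \<le> 0}"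
    using r by (intro exI[of _ r]) (simp add: conj_commute)
qed simp_all

lemma convex_polyhedron_D:
  assumes "convex_polyhedron P"
  shows "P \<subseteq> H3" "interior P \<noteq> {}" "convex P"
proof -
  from assms obtain \<H> where *: "interior P \<noteq> {}" "\<forall>h\<in>\<H>. \<exists>a b. b \<noteq> 0 \<and> h = {x. b \<bullet> x \<le> a}"
    "P = H3 \<inter> \<Inter>\<H>" unfolding convex_polyhedron_def by blast
  then show "P \<subseteq> H3" "interior P \<noteq> {}" by auto
  have "convex h" if "h \<in> \<H>" for h using *(2) that convex_halfspace_le by metis
  then show "convex P" unfolding *(3) by (intro convex_Int convex_Inter convex_ball) auto
qed

text \<open>Of the locally finite family of bounding planes only finitely many come near \<open>x\<close>, and those among them
  that miss \<open>x\<close> can be avoided by a smaller ball.\<close>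

lemma convex_polyhedron_local_cone:
  assumes P: "convex_polyhedron P" and x: "x \<in> P"
  obtains B r where "finite B" "r > 0" "ball x r \<subseteq> H3" "\<forall>b\<in>B. b \<noteq> 0"
    "P \<inter> ball x r = {z \<in> ball x r. \<forall>b\<in>B. b \<bullet> (z - x) \<le> 0}"
    "\<forall>b\<in>B. \<forall>z\<in>P. b \<bullet> (z - x) \<le> 0"
proof -
  from P obtain \<H> where half: "\<forall>h\<in>\<H>. \<exists>a b. b \<noteq> 0 \<and> h = {x. b \<bullet> x \<le> a}"
    and lf: "\<And>K. compact K \<Longrightarrow> K \<subseteq> H3 \<Longrightarrow> finite {h \<in> \<H>. frontier h \<inter> K \<noteq> {}}"
    and PH: "P = H3 \<inter> \<Inter>\<H>" unfolding convex_polyhedron_def by blast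
  have "x \<in> H3" using x PH by blast
  then obtain s where s: "s > 0" "cball x s \<subseteq> H3" by (metis open_ball open_contains_cball)
  define F where "F = {h \<in> \<H>. frontier h \<inter> cball x s \<noteq> {}}"
  have finF: "finite F" using lf[OF compact_cball s(2)] unfolding F_def .
  define A where "A = {h \<in> F. x \<in> frontier h}"
  have "\<forall>h\<in>\<H>. \<exists>b. b \<noteq> 0 \<and> (\<exists>a. h = {z. b \<bullet> z \<le> a})" using half by blast
  from bchoice[OF this]
  obtain n where n: "\<And>h. h \<in> \<H> \<Longrightarrow> n h \<noteq> 0 \<and> (\<exists>a. h = {z. n h \<bullet> z \<le> a})" by blast
  have act: "h = {z. n h \<bullet> (z - x) \<le> 0}" if h: "h \<in> A" for h
  proof -
    obtain a where a: "h = {z. n h \<bullet> z \<le> a}" "n h \<noteq> 0" using n[of h] h by (auto simp: A_def F_def)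
    have "frontier h = {z. n h \<bullet> z = a}" by (subst a(1)) (use a(2) in \<open>simp add: frontier_halfspace_le\<close>)
    then have "a = n h \<bullet> x" using that by (auto simp: A_def)
    then show ?thesis by (subst a(1)) (simp add: inner_diff_right)
  qed
  define U where "U = ball x s \<inter> (\<Inter>h\<in>F - A. interior h)"
  have "open U" unfolding U_def using finF by (intro open_Int open_INT) auto
  moreover have "x \<in> U"
    using s(1) x PH closure_subset by (auto simp: U_def A_def F_def frontier_def)
  ultimately obtain r where r: "r > 0" "ball x r \<subseteq> U" by (metis open_contains_ball)
  have in_h: "ball x r \<subseteq> h" if h: "h \<in> \<H>" "h \<notin> A" for h
  proof (cases "h \<in> F")
    case True
    then show ?thesis using r(2) h(2) interior_subset unfolding U_def by blast
  next
    case False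
    then have "frontier h \<inter> ball x s = {}" using h(1) ball_subset_cball by (auto simp: F_def)
    moreover have "x \<in> ball x s \<inter> h" using s(1) x PH h by auto
    ultimately have "ball x s \<subseteq> h"
      using connected_Int_frontier[OF connected_ball, of x s h] by blast
    then show ?thesis using r(2) unfolding U_def by blast
  qed
  have sub: "ball x r \<subseteq> H3" using r(2) s(2) ball_subset_cball unfolding U_def by blast
  have Pn: "n h \<bullet> (z - x) \<le> 0" if "h \<in> A" "z \<in> P" for h z
  proof -
    have "z \<in> h" using that PH by (auto simp: A_def F_def)
    then show ?thesis using act[OF that(1)] by blast
  qed
  have eq: "P \<inter> ball x r = {z \<in> ball x r. \<forall>b\<in>n ` A. b \<bullet> (z - x) \<le> 0}"
  proof (intro Set.set_eqI iffI)
    fix z assume "z \<in> P \<inter> ball x r"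
    then show "z \<in> {z \<in> ball x r. \<forall>b\<in>n ` A. b \<bullet> (z - x) \<le> 0}" using Pn by blast
  next
    fix z assume z: "z \<in> {z \<in> ball x r. \<forall>b\<in>n ` A. b \<bullet> (z - x) \<le> 0}"
    have "z \<in> h" if "h \<in> \<H>" for h
    proof (cases "h \<in> A")
      case True
      then have "n h \<bullet> (z - x) \<le> 0" using z by blast
      then show ?thesis using act[OF True] by blast
    next
      case False then show ?thesis using in_h[OF that] z by blast
    qed
    then show "z \<in> P \<inter> ball x r" using z sub PH by blast
  qed
  show ?thesis
  proof (rule that[OF _ r(1) sub _ eq])
    show "finite (n ` A)" using finF by (simp add: A_def)
    show "\<forall>b\<in>n ` A. b \<noteq> 0" using n by (auto simp: A_def F_def)
    show "\<forall>b\<in>n ` A. \<forall>z\<in>P. b \<bullet> (z - x) \<le> 0" using Pn by blast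
  qed
qed

lemma interior_halfspace_strict:
  fixes b :: "'a::euclidean_space"
  assumes "q \<in> interior P" "b \<noteq> 0" "\<And>z. z \<in> P \<Longrightarrow> b \<bullet> (z - x) \<le> 0"
  shows "b \<bullet> (q - x) < 0"
proof -
  have "P \<subseteq> {z. b \<bullet> z \<le> b \<bullet> x}" using assms(3) by (auto simp: inner_diff_right)
  then have "q \<in> interior {z. b \<bullet> z \<le> b \<bullet> x}" using assms(1) interior_mono by blast
  then show ?thesis using assms(2) by (simp add: inner_diff_right)
qed

text \<open>The normals of the planes through \<open>x\<close> are orthogonal to \<open>d\<close> and have negative product with the
  direction \<open>v\<close> of an interior point.  Scaled to product \<open>-1\<close> with \<open>v\<close>, they lie on one line, parallel to
  the vector \<open>w\<close> orthogonal to \<open>d\<close> and \<open>v\<close>, and they are convex combinations of the two extreme ones among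
  them.  Hence these two determine the cone.\<close>

lemma convex_polyhedron_local_structure:
  assumes P: "convex_polyhedron P" and x: "x \<in> P" "d \<noteq> 0" "x + d \<in> P" "x - d \<in> P"
  obtains "x \<in> interior P" | b where "locally_halfspace P x b" | b c where "locally_wedge P x d b c"
proof -
  obtain B r where B': "finite B" "r > 0" "ball x r \<subseteq> H3" "\<forall>b\<in>B. b \<noteq> 0"
    "P \<inter> ball x r = {z \<in> ball x r. \<forall>b\<in>B. b \<bullet> (z - x) \<le> 0}"
    "\<forall>b\<in>B. \<forall>z\<in>P. b \<bullet> (z - x) \<le> 0"
    using convex_polyhedron_local_cone[OF P x(1)] .
  note B = B'(1-3) bspec[OF B'(4)] B'(5) bspec[OF bspec[OF B'(6)]]
  have Bd: "b \<bullet> d = 0" if "b \<in> B" for b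
    using B(6)[OF that x(3)] B(6)[OF that x(4)] by simp
  obtain q where q: "q \<in> interior P" using convex_polyhedron_D[OF P] by blast
  define v where "v = q - x"
  have Bv: "b \<bullet> v < 0" if "b \<in> B" for b
    unfolding v_def using interior_halfspace_strict[OF q B(4)[OF that] B(6)[OF that]] .
  show ?thesis
  proof (cases "B = {}")
    case True
    then have "ball x r \<subseteq> P" using B(5) by auto
    then show ?thesis using B(2) that(1) by (meson centre_in_ball interior_maximal open_ball subsetD)
  next
    case False
    define k where "k b = - (1 / (b \<bullet> v))" for b
    have k: "k b > 0" "k b * (b \<bullet> v) = -1" if "b \<in> B" for b
      using Bv[OF that] by (auto simp: k_def divide_simps)
    define w where "w = cross3 d v"
    have w: "w \<bullet> d = 0" "w \<bullet> v = 0" by (auto simp: w_def dot_cross_self)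
    have dv: "p = 0 \<and> q = 0" if "p *\<^sub>R d + q *\<^sub>R v = 0" for p q
    proof -
      obtain b where b: "b \<in> B" using False by blast
      have "b \<bullet> (p *\<^sub>R d + q *\<^sub>R v) = q * (b \<bullet> v)" using Bd[OF b] by (simp add: inner_simps)
      then have "q = 0" using that Bv[OF b] by auto
      then show ?thesis using that x(2) by simp
    qed
    have "w \<noteq> 0"
    proof
      assume "w = 0"
      then have "collinear {0, d, v}" by (simp add: w_def cross_eq_0)
      then obtain c where "v = c *\<^sub>R d" using x(2) dv[of 0 1] by (auto simp: collinear_lemma)
      then show False using dv[of "- c" 1] by simp
    qed
    have ind: "p = 0 \<and> q = 0 \<and> s = 0" if "p *\<^sub>R d + q *\<^sub>R v + s *\<^sub>R w = 0" for p q s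
    proof -
      have "w \<bullet> (p *\<^sub>R d + q *\<^sub>R v + s *\<^sub>R w) = s * (w \<bullet> w)" using w by (simp add: inner_simps)
      then have "s = 0" using that \<open>w \<noteq> 0\<close> by simp
      then show ?thesis using that dv by simp
    qed
    define t where "t b = k b * (b \<bullet> w)" for b
    have tB: "finite (t ` B)" "t ` B \<noteq> {}" using B(1) False by auto
    obtain b where b: "b \<in> B" "t b = Min (t ` B)" using Min_in[OF tB] by (metis imageE)
    obtain c where c: "c \<in> B" "t c = Max (t ` B)" using Max_in[OF tB] by (metis imageE)
    have b: "b \<in> B" "\<And>b'. b' \<in> B \<Longrightarrow> t b \<le> t b'" using b tB(1) by auto
    have c: "c \<in> B" "\<And>b'. b' \<in> B \<Longrightarrow> t b' \<le> t c" using c tB(1) by auto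
    define u where "u = k c *\<^sub>R c - k b *\<^sub>R b"
    have comb: "\<exists>\<mu>\<ge>0. \<mu> \<le> 1 \<and> k a *\<^sub>R a = (1 - \<mu>) *\<^sub>R (k b *\<^sub>R b) + \<mu> *\<^sub>R (k c *\<^sub>R c)" if a: "a \<in> B" for a
    proof -
      define \<mu> where "\<mu> = (if t c = t b then 0 else (t a - t b) / (t c - t b))"
      have l: "0 \<le> \<mu>" "\<mu> \<le> 1" "t a = (1 - \<mu>) * t b + \<mu> * t c"
        using b(2)[OF a] c(2)[OF a] b(2)[OF c(1)] by (auto simp: \<mu>_def divide_simps) (simp add: algebra_simps)
      define m where "m = k a *\<^sub>R a - ((1 - \<mu>) *\<^sub>R (k b *\<^sub>R b) + \<mu> *\<^sub>R (k c *\<^sub>R c))"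
      have "m \<bullet> d = 0" using Bd a b c by (simp add: m_def inner_simps)
      moreover have "m \<bullet> v = 0"
      proof -
        have "m \<bullet> v = k a * (a \<bullet> v) - ((1 - \<mu>) * (k b * (b \<bullet> v)) + \<mu> * (k c * (c \<bullet> v)))"
          by (simp add: m_def inner_simps)
        then show ?thesis using k(2) a b(1) c(1) by simp
      qed
      moreover have "m \<bullet> w = 0" using l(3) by (simp add: m_def inner_simps t_def)
      ultimately have "m = 0" using orthogonal_to_basis_imp_0[OF ind] by blast
      then show ?thesis using l by (auto simp: m_def)
    qed
    have two: "(\<forall>a\<in>B. a \<bullet> y \<le> 0) \<longleftrightarrow> b \<bullet> y \<le> 0 \<and> c \<bullet> y \<le> 0" for y
    proof
      assume bc: "b \<bullet> y \<le> 0 \<and> c \<bullet> y \<le> 0"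
      show "\<forall>a\<in>B. a \<bullet> y \<le> 0"
      proof
        fix a assume a: "a \<in> B"
        obtain \<mu> where l: "0 \<le> \<mu>" "\<mu> \<le> 1" "k a *\<^sub>R a = (1 - \<mu>) *\<^sub>R (k b *\<^sub>R b) + \<mu> *\<^sub>R (k c *\<^sub>R c)"
          using comb[OF a] by (elim exE conjE, intro that)
        have "k a * (a \<bullet> y) = (k a *\<^sub>R a) \<bullet> y" by simp
        also have "\<dots> = (1 - \<mu>) * (k b * (b \<bullet> y)) + \<mu> * (k c * (c \<bullet> y))"
          by (simp only: l(3) inner_add_left inner_scaleR_left)
        also have "\<dots> \<le> 0"
          using l(1,2) bc k(1)[OF b(1)] k(1)[OF c(1)]
          by (intro add_nonpos_nonpos mult_nonneg_nonpos) auto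
        finally show "a \<bullet> y \<le> 0" using k(1)[OF a] by (simp add: mult_le_0_iff)
      qed
    next
      assume "\<forall>a\<in>B. a \<bullet> y \<le> 0"
      then show "b \<bullet> y \<le> 0 \<and> c \<bullet> y \<le> 0" using b(1) c(1) by simp
    qed
    have loc: "P \<inter> ball x r = {z \<in> ball x r. b \<bullet> (z - x) \<le> 0 \<and> c \<bullet> (z - x) \<le> 0}"
      unfolding B(5) two ..
    show ?thesis
    proof (cases "t b = t c")
      case True
      have "k c *\<^sub>R c = k b *\<^sub>R b"
      proof -
        have "u \<bullet> d = 0" using Bd b c by (simp add: u_def inner_simps)
        moreover have "u \<bullet> v = 0" using k(2) b c by (simp add: u_def inner_simps)
        moreover have "u \<bullet> w = 0" using True by (simp add: u_def inner_simps t_def)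
        ultimately have "u = 0" using orthogonal_to_basis_imp_0[OF ind] by blast
        then show ?thesis by (simp add: u_def)
      qed
      then have e: "k c * (c \<bullet> y) = k b * (b \<bullet> y)" for y by (metis inner_scaleR_left)
      have "c \<bullet> y \<le> 0 \<longleftrightarrow> b \<bullet> y \<le> 0" for y
      proof -
        have "c \<bullet> y \<le> 0 \<longleftrightarrow> k c * (c \<bullet> y) \<le> 0" "b \<bullet> y \<le> 0 \<longleftrightarrow> k b * (b \<bullet> y) \<le> 0"
          using k(1)[OF b(1)] k(1)[OF c(1)] by (auto simp: mult_le_0_iff)
        then show ?thesis by (simp only: e)
      qed
      then have "locally_halfspace P x b"
        unfolding locally_halfspace_def using loc B(2,3,4) b(1) by auto
      then show ?thesis using that(2) by blast
    next
      case False
      then have less: "t b < t c" using b(2)[OF c(1)] by simp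
      have inn: "a \<bullet> (w + t' *\<^sub>R v) = (t a - t') / k a" if "a \<in> B" for a t'
        using k[OF that] by (simp add: inner_simps t_def field_simps)
      have "b \<bullet> - (w + t b *\<^sub>R v) = 0" "c \<bullet> - (w + t b *\<^sub>R v) < 0"
        "c \<bullet> (w + t c *\<^sub>R v) = 0" "b \<bullet> (w + t c *\<^sub>R v) < 0"
        unfolding inner_minus_right inn[OF b(1)] inn[OF c(1)] using less k(1)[OF b(1)] k(1)[OF c(1)]
        by (auto simp: divide_neg_pos)
      then have "locally_wedge P x d b c"
        unfolding locally_wedge_def using loc B(2,3) Bd b(1) c(1) by blast
      then show ?thesis using that(3) by blast
    qed
  qed
qed

section \<open>Facets and edges near a point\<close>

lemma opposite_ne: "d \<noteq> 0 \<Longrightarrow> x - d \<noteq> x + (d::point)"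
  by (auto simp: vec_eq_iff)

text \<open>The face cut out by the plane through \<open>x\<close> with normal \<open>b\<close>, if this plane supports \<open>P\<close>.\<close>

definition wall :: "point set \<Rightarrow> point \<Rightarrow> point \<Rightarrow> point set" where
  "wall P x b = {z \<in> P. b \<bullet> (z - x) = 0}"

lemma wall_subset: "wall P x b \<subseteq> P"
  by (auto simp: wall_def)

lemma locally_nonpos_imp_nonpos:
  assumes P: "convex P" "x \<in> P" and r: "r > 0"
    and loc: "\<And>z. z \<in> P \<Longrightarrow> z \<in> ball x r \<Longrightarrow> b \<bullet> (z - x) \<le> 0" and z: "z \<in> P"
  shows "b \<bullet> (z - x) \<le> 0"
proof -
  obtain t where t: "t > 0" "t \<le> 1" "\<And>s. \<bar>s\<bar> \<le> t \<Longrightarrow> x + s *\<^sub>R (z - x) \<in> ball x r"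
    using small_step[OF r] by metis
  have "x + t *\<^sub>R (z - x) \<in> ball x r" using t by simp
  moreover have "x + t *\<^sub>R (z - x) \<in> P" using convex_step[OF P z] t by simp
  ultimately have "t * (b \<bullet> (z - x)) \<le> 0" using loc[of "x + t *\<^sub>R (z - x)"] by simp
  then show ?thesis using t(1) by (simp add: mult_le_0_iff)
qed

lemma wall_face_of:
  assumes "convex P" "\<And>z. z \<in> P \<Longrightarrow> b \<bullet> (z - x) \<le> 0"
  shows "wall P x b face_of P"
proof -
  have "wall P x b = P \<inter> {z. b \<bullet> z = b \<bullet> x}" by (auto simp: wall_def inner_diff_right)
  then show ?thesis
    using face_of_Int_supporting_hyperplane_le[of P b "b \<bullet> x"] assms by (auto simp: inner_diff_right)
qed

lemma aff_dim_disc_le: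
  fixes b :: point
  assumes b: "b \<noteq> 0" and r: "r > 0" and S: "{z \<in> ball x r. b \<bullet> (z - x) = 0} \<subseteq> S"
  shows "2 \<le> aff_dim S"
proof -
  let ?A = "{z. b \<bullet> z = b \<bullet> x}"
  have "affine hull (?A \<inter> ball x r) = affine hull ?A"
    using r by (intro affine_hull_affine_Int_nonempty_interior affine_hyperplane) (auto simp: interior_open)
  then have "aff_dim (?A \<inter> ball x r) = aff_dim ?A" by (metis aff_dim_affine_hull)
  also have "\<dots> = 2" using b by simp
  finally have "aff_dim (?A \<inter> ball x r) = 2" .
  moreover have "?A \<inter> ball x r \<subseteq> S" using S by (auto simp: inner_diff_right)
  ultimately show ?thesis using aff_dim_subset by metis
qed

lemma collinear_edge:
  fixes x d :: "'a::euclidean_space"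
  assumes dim: "aff_dim e = 1" and x: "x \<in> e" "x + d \<in> e" "d \<noteq> 0" and z: "z \<in> e"
  shows "\<exists>q. z = x + q *\<^sub>R d"
proof -
  have hull: "affine hull e = affine hull {x, x + d}"
    using aff_dim_eq_full_gen[of "{x, x + d}" e] x dim by simp
  have "z \<in> affine hull e" using z by (rule hull_inc)
  then obtain p q where pq: "p + q = 1" "z = p *\<^sub>R x + q *\<^sub>R (x + d)"
    unfolding hull affine_hull_2 by blast
  have "z = (p + q) *\<^sub>R x + q *\<^sub>R d" by (simp add: pq(2) algebra_simps)
  then show ?thesis unfolding pq(1) by auto
qed

context
  fixes P :: "point set"
  assumes P: "convex_polyhedron P"
begin

lemmas P_convex = convex_polyhedron_D(3)[OF P]

lemma aff_dim_P: "aff_dim P = 3"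
  using aff_dim_nonempty_interior[OF convex_polyhedron_D(2)[OF P]] by simp

lemma proper_face_aff_dim: "F face_of P \<Longrightarrow> F \<noteq> P \<Longrightarrow> aff_dim F \<le> 2"
  using face_of_aff_dim_lt[OF P_convex, of F] aff_dim_P by simp

lemma facet_iff: "F facet_of P \<longleftrightarrow> F face_of P \<and> aff_dim F = 2"
  using aff_dim_P by (auto simp: facet_of_def)

lemma wall_ne:
  assumes "b \<noteq> 0" "\<And>z. z \<in> P \<Longrightarrow> b \<bullet> (z - x) \<le> 0"
  shows "wall P x b \<noteq> P"
proof
  assume e: "wall P x b = P"
  obtain q where "q \<in> interior P" using convex_polyhedron_D(2)[OF P] by blast
  then have "b \<bullet> (q - x) < 0" "q \<in> P"
    using interior_halfspace_strict[of q P b x] assms interior_subset by blast+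
  then show False using e unfolding wall_def by force
qed

lemma locally_halfspace_facet:
  assumes x: "x \<in> P" and h: "locally_halfspace P x b"
  shows "\<And>z. z \<in> P \<Longrightarrow> b \<bullet> (z - x) \<le> 0" "wall P x b facet_of P" "x \<in> wall P x b"
proof -
  obtain r where b: "b \<noteq> 0" and r: "r > 0" "P \<inter> ball x r = {z \<in> ball x r. b \<bullet> (z - x) \<le> 0}"
    using h unfolding locally_halfspace_def by blast
  show np: "b \<bullet> (z - x) \<le> 0" if "z \<in> P" for z
    using locally_nonpos_imp_nonpos[OF P_convex x r(1) _ that] r(2) by blast
  have face: "wall P x b face_of P" using wall_face_of[OF P_convex np] .
  have "aff_dim (wall P x b) \<le> 2" using proper_face_aff_dim[OF face wall_ne[OF b np]] .
  moreover have "{z \<in> ball x r. b \<bullet> (z - x) = 0} \<subseteq> wall P x b"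
  proof
    fix z assume "z \<in> {z \<in> ball x r. b \<bullet> (z - x) = 0}"
    then have "z \<in> {z \<in> ball x r. b \<bullet> (z - x) \<le> 0}" "b \<bullet> (z - x) = 0" by auto
    then show "z \<in> wall P x b" using r(2) unfolding wall_def by blast
  qed
  then have "2 \<le> aff_dim (wall P x b)" by (rule aff_dim_disc_le[OF b r(1)])
  ultimately show "wall P x b facet_of P" using face facet_iff by simp
  show "x \<in> wall P x b" using x by (simp add: wall_def)
qed

lemma locally_wedge_D:
  assumes x: "x \<in> P" and w: "locally_wedge P x d b c"
  shows "b \<noteq> 0" "\<And>z. z \<in> P \<Longrightarrow> b \<bullet> (z - x) \<le> 0" "wall P x b face_of P" "wall P x b \<noteq> P"
    "\<exists>z\<in>wall P x b. c \<bullet> (z - x) < 0"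
proof -
  obtain v w where vw: "b \<bullet> v = 0" "c \<bullet> v < 0" "c \<bullet> w = 0" "b \<bullet> w < 0"
    using w unfolding locally_wedge_def by blast
  obtain r where r: "r > 0" "P \<inter> ball x r = {z \<in> ball x r. b \<bullet> (z - x) \<le> 0 \<and> c \<bullet> (z - x) \<le> 0}"
    using w unfolding locally_wedge_def by blast
  show b: "b \<noteq> 0" using vw(4) by auto
  show np: "b \<bullet> (z - x) \<le> 0" if "z \<in> P" for z
    using locally_nonpos_imp_nonpos[OF P_convex x r(1) _ that] r(2) by blast
  show "wall P x b face_of P" using wall_face_of[OF P_convex np] .
  show "wall P x b \<noteq> P" using wall_ne[OF b np] .
  obtain t where t: "t > 0" "\<And>s. \<bar>s\<bar> \<le> t \<Longrightarrow> x + s *\<^sub>R v \<in> ball x r"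
    using small_step[OF r(1)] by metis
  define z where "z = x + t *\<^sub>R v"
  have z: "z \<in> ball x r" "b \<bullet> (z - x) = 0" "c \<bullet> (z - x) < 0"
    using t vw by (auto simp: z_def mult_pos_neg)
  then have "z \<in> {z \<in> ball x r. b \<bullet> (z - x) \<le> 0 \<and> c \<bullet> (z - x) \<le> 0}" by simp
  then have "z \<in> P" using r(2) by blast
  then show "\<exists>z\<in>wall P x b. c \<bullet> (z - x) < 0" using z unfolding wall_def by blast
qed

lemma locally_wedge_edge:
  assumes x: "x \<in> P" "d \<noteq> 0" "x + d \<in> P" and w: "locally_wedge P x d b c"
  shows "wall P x b \<inter> wall P x c edge_of P"
    "x \<in> wall P x b \<inter> wall P x c" "x + d \<in> wall P x b \<inter> wall P x c"
proof -
  note D = locally_wedge_D[OF x(1) w]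
  note D' = locally_wedge_D[OF x(1) locally_wedge_commute[OF w]]
  let ?e = "wall P x b \<inter> wall P x c"
  have d: "b \<bullet> d = 0" "c \<bullet> d = 0" using w by (auto simp: locally_wedge_def)
  show xe: "x \<in> ?e" "x + d \<in> ?e" using x d by (auto simp: wall_def)
  have "?e face_of wall P x b"
    using face_of_subset[OF face_of_Int[OF D(3) D'(3)]] wall_subset by blast
  moreover have "?e \<noteq> wall P x b" using D(5) unfolding wall_def by force
  ultimately have "aff_dim ?e < aff_dim (wall P x b)"
    using face_of_aff_dim_lt face_of_imp_convex[OF D(3)] by blast
  also have "\<dots> \<le> 2" using proper_face_aff_dim[OF D(3,4)] .
  finally have "aff_dim ?e \<le> 1" by simp
  moreover have "aff_dim {x, x + d} \<le> aff_dim ?e" using xe by (intro aff_dim_subset) auto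
  ultimately have "aff_dim ?e = 1" using x(2) by simp
  then show "?e edge_of P" using face_of_Int[OF D(3) D'(3)] by (simp add: edge_of_def)
qed

text \<open>A facet through \<open>x\<close> has no point strictly inside both half-spaces, since segments from \<open>x\<close> to such a point
  enter the interior.  By convexity it then lies in a single wall, and having the dimension of the
  wall it is the wall.\<close>

lemma facet_at_wedge:
  assumes x: "x \<in> P" and w: "locally_wedge P x d b c" and \<tau>: "\<tau> facet_of P" "x \<in> \<tau>"
  shows "\<tau> = wall P x b \<or> \<tau> = wall P x c"
proof -
  note D = locally_wedge_D[OF x w]
  note D' = locally_wedge_D[OF x locally_wedge_commute[OF w]]
  obtain r where r: "r > 0" "P \<inter> ball x r = {z \<in> ball x r. b \<bullet> (z - x) \<le> 0 \<and> c \<bullet> (z - x) \<le> 0}"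
    using w unfolding locally_wedge_def by blast
  have face: "\<tau> face_of P" and dim: "aff_dim \<tau> = 2" using \<tau>(1) facet_iff by auto
  have sub: "\<tau> \<subseteq> P" and cv: "convex \<tau>" using face face_of_imp_subset face_of_imp_convex by blast+
  have "\<tau> \<noteq> P" using dim aff_dim_P by auto
  then have dis: "\<tau> \<inter> interior P = {}" using face_of_disjoint_interior[OF face] by blast
  have no: False if z: "z \<in> \<tau>" "b \<bullet> (z - x) < 0" "c \<bullet> (z - x) < 0" for z
  proof -
    obtain t where t: "t > 0" "t \<le> 1" "\<And>s. \<bar>s\<bar> \<le> t \<Longrightarrow> x + s *\<^sub>R (z - x) \<in> ball x r"
      using small_step[OF r(1)] by metis
    define y where "y = x + t *\<^sub>R (z - x)"
    have y: "y \<in> ball x r" "b \<bullet> (y - x) < 0" "c \<bullet> (y - x) < 0"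
      using t z by (auto simp: y_def mult_pos_neg)
    have y\<tau>: "y \<in> \<tau>" unfolding y_def using convex_step[OF cv \<tau>(2) z(1)] t by simp
    let ?U = "ball x r \<inter> {y. b \<bullet> (y - x) < 0} \<inter> {y. c \<bullet> (y - x) < 0}"
    have "open ?U"
      by (intro open_Int open_ball open_Collect_less continuous_intros)
    moreover have "?U \<subseteq> P \<inter> ball x r" unfolding r(2) by auto
    ultimately have "?U \<subseteq> interior P" by (intro interior_maximal) auto
    then show False using y y\<tau> dis by blast
  qed
  have "\<tau> \<subseteq> wall P x b \<or> \<tau> \<subseteq> wall P x c"
  proof (rule ccontr)
    assume "\<not> ?thesis"
    then obtain z y where zy: "z \<in> \<tau>" "z \<notin> wall P x b" "y \<in> \<tau>" "y \<notin> wall P x c" by blast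
    then have 1: "b \<bullet> (z - x) < 0" "c \<bullet> (y - x) < 0"
      using D(2)[of z] D'(2)[of y] sub by (auto simp: wall_def)
    have 2: "c \<bullet> (z - x) \<le> 0" "b \<bullet> (y - x) \<le> 0" using D(2)[of y] D'(2)[of z] sub zy by auto
    have m: "midpoint z y \<in> \<tau>" using cv zy by (simp add: convexD_alt midpoint_def
          convex_def scaleR_add_right)
    have mid: "2 * (a \<bullet> (midpoint z y - x)) = a \<bullet> (z - x) + a \<bullet> (y - x)" for a
      by (simp add: midpoint_def inner_simps)
    have "b \<bullet> (midpoint z y - x) < 0" using mid[of b] 1 2 by linarith
    moreover have "c \<bullet> (midpoint z y - x) < 0" using mid[of c] 1 2 by linarith
    ultimately
    show False by (rule no[OF m])
  qed
  moreover have "\<tau> = wall P x a" if "\<tau> \<subseteq> wall P x a" "wall P x a face_of P" "wall P x a \<noteq> P" for a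
  proof (rule ccontr)
    assume "\<tau> \<noteq> wall P x a"
    moreover have "\<tau> face_of wall P x a" using face_of_subset[OF face that(1) wall_subset] .
    ultimately have "aff_dim \<tau> < aff_dim (wall P x a)"
      using face_of_aff_dim_lt face_of_imp_convex[OF that(2)] by blast
    then show False using proper_face_aff_dim[OF that(2,3)] dim by simp
  qed
  ultimately show ?thesis using D D' by blast
qed

text \<open>At a point inside an edge \<open>P\<close> can only be a wedge.  The edge would be all of \<open>P\<close> if it met the interior,
  and it would contain a disc around \<open>x\<close> if \<open>P\<close> were a half-space there.\<close>

lemma edge_locally_wedge:
  assumes e: "e edge_of P" and x: "x \<in> e" "d \<noteq> 0" "x + d \<in> P" "x - d \<in> P"
  obtains b c where "locally_wedge P x d b c"
proof -
  have face: "e face_of P" and dim: "aff_dim e = 1" using e by (auto simp: edge_of_def)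
  have xP: "x \<in> P" using x(1) face face_of_imp_subset by blast
  from convex_polyhedron_local_structure[OF P xP x(2-4)] show ?thesis
  proof cases
    case 1
    have "e \<noteq> P" using dim aff_dim_P by auto
    then show ?thesis using face_of_disjoint_interior[OF face] 1 x(1) by blast
  next
    case (2 b)
    obtain r where b: "b \<noteq> 0" and r: "r > 0" "P \<inter> ball x r = {z \<in> ball x r. b \<bullet> (z - x) \<le> 0}"
      using 2 unfolding locally_halfspace_def by blast
    have "{z \<in> ball x r. b \<bullet> (z - x) = 0} \<subseteq> e"
    proof
      fix z assume z: "z \<in> {z \<in> ball x r. b \<bullet> (z - x) = 0}"
      define y where "y = x - (z - x)"
      have "dist x y = dist x z" by (simp add: y_def dist_norm norm_minus_commute)
      moreover have "b \<bullet> (y - x) = - (b \<bullet> (z - x))" by (simp add: y_def inner_simps)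
      ultimately have "z \<in> {z \<in> ball x r. b \<bullet> (z - x) \<le> 0}" "y \<in> {z \<in> ball x r. b \<bullet> (z - x) \<le> 0}"
        using z by auto
      then have zyP: "z \<in> P" "y \<in> P" using r(2) by blast+
      show "z \<in> e"
      proof (cases "z = x")
        case False
        have "x = midpoint y z" by (simp add: y_def midpoint_def)
        moreover have "y \<noteq> z" using opposite_ne[of "z - x" x] False unfolding y_def
          by (metis add.commute diff_add_cancel right_minus_eq)
        ultimately have "x \<in> open_segment y z" by (simp add: midpoint_in_open_segment)
        then show ?thesis using face zyP x(1) unfolding face_of_def by blast
      qed (use x(1) in simp)
    qed
    from aff_dim_disc_le[OF b r(1) this] show ?thesis using dim by simp
  next
    case (3 b c)
    then show ?thesis by (rule that)
  qed
qed

lemma edge_walls: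
  assumes e: "e edge_of P" and x: "x \<in> e" "d \<noteq> 0" "x + d \<in> P" "x - d \<in> P"
    and w: "locally_wedge P x d b c"
  shows "wall P x b facet_of P" "wall P x c facet_of P" "wall P x b \<noteq> wall P x c"
    "e \<subseteq> wall P x b" "e \<subseteq> wall P x c"
proof -
  have face: "e face_of P" and dim: "aff_dim e = 1" using e by (auto simp: edge_of_def)
  have xP: "x \<in> P" using x(1) face face_of_imp_subset by blast
  have de: "x + d \<in> e"
  proof -
    have "x = midpoint (x - d) (x + d)" by (simp add: midpoint_def scaleR_2[symmetric])
    then have "x \<in> open_segment (x - d) (x + d)"
      using midpoint_in_open_segment[of "x - d" "x + d"] opposite_ne[OF x(2), of x] by simp
    then show ?thesis using face x unfolding face_of_def by blast
  qed
  have line: "\<exists>q. z = x + q *\<^sub>R d" if z: "z \<in> e" for z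
    using collinear_edge[OF dim x(1) de x(2) z] .
  have one: "e \<subseteq> wall P x b" "wall P x b facet_of P" if w: "locally_wedge P x d b c" for b c
  proof -
    note D = locally_wedge_D[OF xP w]
    have bd: "b \<bullet> d = 0" using w by (simp add: locally_wedge_def)
    show sub: "e \<subseteq> wall P x b"
    proof
      fix z assume z: "z \<in> e"
      then obtain q where "z = x + q *\<^sub>R d" using line by blast
      then have "b \<bullet> (z - x) = 0" using bd by simp
      then show "z \<in> wall P x b" using z face face_of_imp_subset unfolding wall_def by blast
    qed
    have "e face_of wall P x b" using face_of_subset[OF face sub wall_subset] .
    moreover have "e \<noteq> wall P x b"
    proof
      assume eq: "e = wall P x b"
      obtain z where z: "z \<in> wall P x b" "c \<bullet> (z - x) < 0" using D(5) by blast
      then obtain q where "z = x + q *\<^sub>R d" using line eq by blast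
      then have "c \<bullet> (z - x) = 0" using w by (simp add: locally_wedge_def)
      then show False using z by simp
    qed
    ultimately have "aff_dim e < aff_dim (wall P x b)"
      using face_of_aff_dim_lt face_of_imp_convex[OF D(3)] by blast
    then have "aff_dim (wall P x b) = 2" using dim proper_face_aff_dim[OF D(3,4)] by simp
    then show "wall P x b facet_of P" using D(3) facet_iff by simp
  qed
  show "wall P x b facet_of P" "e \<subseteq> wall P x b" using one[OF w] by auto
  show "wall P x c facet_of P" "e \<subseteq> wall P x c" using one[OF locally_wedge_commute[OF w]] by auto
  show "wall P x b \<noteq> wall P x c" using locally_wedge_D(5)[OF xP w] unfolding wall_def by force
qed

lemma edge_has_midpoint:
  assumes e: "e edge_of P"
  obtains x d where "d \<noteq> 0" "x \<in> e" "x + d \<in> e" "x - d \<in> e"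
proof -
  have dim: "aff_dim e = 1" and cv: "convex e" using e face_of_imp_convex by (auto simp: edge_of_def)
  have "e \<noteq> {}" using dim by auto
  then obtain p where p: "p \<in> e" by blast
  have "e \<noteq> {p}" using dim by auto
  then obtain q where q: "q \<in> e" "q \<noteq> p" using p by blast
  define d where "d = (1/2) *\<^sub>R (q - p)"
  have "p + d \<in> e" using convex_step[OF cv p q(1), of "1/2"] by (simp add: d_def)
  moreover have "(p + d) + d = q" by (simp add: d_def vec_eq_iff field_simps)
  ultimately show ?thesis using that[of d "p + d"] p q by (simp add: d_def)
qed

text \<open>An edge lies in exactly two facets, so the description that defines \<open>other_face\<close> has a unique
  solution, and following an edge through the face identifications never leaves the edges of \<open>P\<close>.\<close>

lemma other_face_facet:
  assumes e: "e edge_of P" and \<sigma>: "\<sigma> facet_of P" "e \<subseteq> \<sigma>"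
  shows "other_face P e \<sigma> facet_of P" "e \<subseteq> other_face P e \<sigma>"
proof -
  have eP: "e \<subseteq> P" using e edge_of_imp_subset by blast
  obtain x d where x: "d \<noteq> 0" "x \<in> e" "x + d \<in> e" "x - d \<in> e" using edge_has_midpoint[OF e] .
  then have xP: "x + d \<in> P" "x - d \<in> P" "x \<in> P" using eP by auto
  obtain b c where w: "locally_wedge P x d b c" using edge_locally_wedge[OF e x(2,1) xP(1,2)] .
  note W = edge_walls[OF e x(2,1) xP(1,2) w]
  have all: "\<tau> = wall P x b \<or> \<tau> = wall P x c" if "\<tau> facet_of P" "e \<subseteq> \<tau>" for \<tau>
    using facet_at_wedge[OF xP(3) w that(1)] that(2) x(2) by blast
  have "\<exists>!\<tau>. \<tau> facet_of P \<and> e \<subseteq> \<tau> \<and> \<tau> \<noteq> \<sigma>"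
    using all[OF \<sigma>] W all by metis
  from theI'[OF this] show "other_face P e \<sigma> facet_of P" "e \<subseteq> other_face P e \<sigma>"
    unfolding other_face_def by auto
qed

end

section \<open>Outward normals and dihedral angles\<close>

text \<open>The Minkowski vector of a Euclidean plane through \<open>x\<close> with normal \<open>b\<close> is \<open>(b \<bullet> x, b)\<close>: it is
  orthogonal to the timelike vector \<open>(1, x)\<close>, hence spacelike, and can be scaled to a unit vector.\<close>

definition minkowski_normal :: "point \<Rightarrow> point \<Rightarrow> real \<times> point" where
  "minkowski_normal x b = (1 / sqrt (lorentz (b \<bullet> x, b) (b \<bullet> x, b))) *\<^sub>R (b \<bullet> x, b)"

lemma lorentz_plane_vector:
  "lorentz (b \<bullet> x, b) (1, z) = b \<bullet> (z - x)" "lorentz (b \<bullet> x, b) (0, v) = b \<bullet> v"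
  by (auto simp: lorentz_def inner_diff_right)

lemma orthogonal_to_timelike_eq: "lorentz m (1, x) = 0 \<Longrightarrow> m = (snd m \<bullet> x, snd m)"
  by (simp add: lorentz_def prod_eq_iff)

lemma spacelike_plane_vector:
  assumes "x \<in> H3" "b \<noteq> 0"
  shows "lorentz (b \<bullet> x, b) (b \<bullet> x, b) > 0"
proof -
  have bb: "b \<bullet> b > 0" using assms(2) by simp
  have "(b \<bullet> x)\<^sup>2 \<le> (b \<bullet> b) * (x \<bullet> x)" by (rule Cauchy_Schwarz_ineq)
  also have "\<dots> < (b \<bullet> b) * 1" using assms(1) bb unfolding mem_H3_iff by (intro mult_strict_left_mono)
  finally show ?thesis by (simp add: lorentz_def power2_eq_square)
qed

text \<open>The Lorentz form is positive definite on the complement of a timelike vector.\<close>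

lemma orthogonal_to_timelike_pos:
  assumes "x \<in> H3" "lorentz m (1, x) = 0" "m \<noteq> 0"
  shows "lorentz m m > 0"
proof -
  have m: "m = (snd m \<bullet> x, snd m)" using orthogonal_to_timelike_eq[OF assms(2)] .
  then have "snd m \<noteq> 0" using assms(3) by (metis inner_zero_left zero_prod_def)
  then show ?thesis using spacelike_plane_vector[OF assms(1), of "snd m"] m by simp
qed

lemma parallel_if_orthogonal:
  fixes b b' :: "'a::euclidean_space"
  assumes "b \<noteq> 0" "\<And>v. b \<bullet> v = 0 \<Longrightarrow> b' \<bullet> v = 0"
  obtains l where "b' = l *\<^sub>R b"
proof -
  define l where "l = (b' \<bullet> b) / (b \<bullet> b)"
  define v where "v = b' - l *\<^sub>R b"
  have "b \<bullet> v = 0" using assms(1) by (simp add: v_def l_def inner_simps inner_commute)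
  then have "b' \<bullet> v = 0" using assms(2) by blast
  then have "v \<bullet> v = 0" using \<open>b \<bullet> v = 0\<close> by (simp add: v_def inner_diff_left)
  then show ?thesis using that[of l] by (simp add: v_def)
qed

lemma minkowski_normal_scale:
  assumes "x \<in> H3" "b \<noteq> 0"
  obtains s where "s > 0" "minkowski_normal x b = s *\<^sub>R (b \<bullet> x, b)"
    "lorentz (minkowski_normal x b) (minkowski_normal x b) = 1"
    "s\<^sup>2 * lorentz (b \<bullet> x, b) (b \<bullet> x, b) = 1"
proof -
  define N where "N = lorentz (b \<bullet> x, b) (b \<bullet> x, b)"
  have N: "N > 0" using spacelike_plane_vector[OF assms] by (simp add: N_def)
  define s where "s = 1 / sqrt N"
  have s: "s > 0" "s\<^sup>2 * N = 1" using N by (auto simp: s_def power_divide)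
  have m: "minkowski_normal x b = s *\<^sub>R (b \<bullet> x, b)" by (simp add: minkowski_normal_def s_def N_def)
  have "lorentz (minkowski_normal x b) (minkowski_normal x b) = s\<^sup>2 * N"
    unfolding m lorentz_scaleR_left lorentz_scaleR_right N_def by (simp add: power2_eq_square)
  then show ?thesis using that[of s] s m by (simp add: N_def)
qed

text \<open>A facet spans its plane, so the conditions on the outward normal determine it up to a scalar; unit
  length fixes the absolute value of the scalar, and the side on which \<open>P\<close> lies fixes the sign.\<close>

lemma outward_normal_wall:
  assumes P: "convex_polyhedron P" and x: "x \<in> P" and b: "b \<noteq> 0"
    and np: "\<And>z. z \<in> P \<Longrightarrow> b \<bullet> (z - x) \<le> 0" and fac: "wall P x b facet_of P"
  shows "outward_normal P (wall P x b) = minkowski_normal x b"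
proof -
  have xH: "x \<in> H3" using x convex_polyhedron_D[OF P] by blast
  obtain s where s: "s > 0" "minkowski_normal x b = s *\<^sub>R (b \<bullet> x, b)"
    "lorentz (minkowski_normal x b) (minkowski_normal x b) = 1"
    "s\<^sup>2 * lorentz (b \<bullet> x, b) (b \<bullet> x, b) = 1"
    using minkowski_normal_scale[OF xH b] .
  have dim: "aff_dim (wall P x b) = 2" using facet_iff[OF P] fac by blast
  have hyp: "affine hull (wall P x b) = {z. b \<bullet> z = b \<bullet> x}"
  proof (rule affine_dim_equal)
    show "affine hull (wall P x b) \<subseteq> {z. b \<bullet> z = b \<bullet> x}"
      by (rule hull_minimal[where S = affine, OF _ affine_hyperplane]) (auto simp: wall_def inner_diff_right)
    show "aff_dim (affine hull (wall P x b)) = aff_dim {z. b \<bullet> z = b \<bullet> x}" using dim b by simp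
    show "affine hull (wall P x b) \<noteq> {}" using x by (auto simp: wall_def)
  qed (auto intro: affine_hyperplane affine_affine_hull)
  show ?thesis
    unfolding outward_normal_def
  proof (rule the_equality)
    show "lorentz (minkowski_normal x b) (minkowski_normal x b) = 1 \<and>
        (\<forall>z\<in>P. lorentz (minkowski_normal x b) (1, z) \<le> 0) \<and>
        (\<forall>z\<in>wall P x b. lorentz (minkowski_normal x b) (1, z) = 0)"
      using s(3) s(1) np unfolding s(2) lorentz_scaleR_left lorentz_plane_vector
      by (auto simp: wall_def mult_le_0_iff)
  next
    fix n
    assume n: "lorentz n n = 1 \<and> (\<forall>z\<in>P. lorentz n (1, z) \<le> 0) \<and> (\<forall>z\<in>wall P x b. lorentz n (1, z) = 0)"
    obtain a b' where nab: "n = (a, b')" by (cases n)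
    have "wall P x b \<subseteq> {z. b' \<bullet> z = a}" using n by (auto simp: nab lorentz_def)
    then have "affine hull (wall P x b) \<subseteq> {z. b' \<bullet> z = a}" by (rule hull_minimal[where S = affine, OF _ affine_hyperplane])
    then have pl: "b' \<bullet> z = a" if "b \<bullet> z = b \<bullet> x" for z using hyp that by blast
    have a: "a = b' \<bullet> x" using pl[of x] by simp
    have "b' \<bullet> v = 0" if "b \<bullet> v = 0" for v
      using pl[of "x + v"] that a by (simp add: inner_add_right)
    then obtain l where l: "b' = l *\<^sub>R b" using parallel_if_orthogonal[OF b] by metis
    have nl: "n = l *\<^sub>R (b \<bullet> x, b)" by (simp add: nab a l)
    obtain q where q: "q \<in> interior P" using convex_polyhedron_D(2)[OF P] by blast
    have "b \<bullet> (q - x) < 0" using interior_halfspace_strict[OF q b np] .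
    moreover have "l * (b \<bullet> (q - x)) \<le> 0"
    proof -
      have "lorentz n (1, q) \<le> 0" using n q interior_subset by blast
      then show ?thesis unfolding nl lorentz_scaleR_left lorentz_plane_vector .
    qed
    ultimately have "l \<ge> 0" by (auto simp: mult_le_0_iff)
    have "l\<^sup>2 * lorentz (b \<bullet> x, b) (b \<bullet> x, b) = 1"
    proof -
      have "lorentz n n = 1" using n by blast
      then show ?thesis unfolding nl lorentz_scaleR_left lorentz_scaleR_right
        by (simp add: power2_eq_square)
    qed
    then have "l\<^sup>2 = s\<^sup>2" using s(4) spacelike_plane_vector[OF xH b] by (metis less_irrefl mult_right_cancel)
    then have "l = s" using \<open>l \<ge> 0\<close> s(1) by (simp add: power2_eq_iff_nonneg)
    then show "n = minkowski_normal x b" using nl s(2) by simp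
  qed
qed

lemma locally_wedge_interior:
  assumes w: "locally_wedge P x d b c"
  obtains r where "r > 0" "\<And>z. z \<in> ball x r \<Longrightarrow> b \<bullet> (z - x) < 0 \<Longrightarrow> c \<bullet> (z - x) < 0 \<Longrightarrow> z \<in> interior P"
proof -
  obtain r where r: "r > 0" "P \<inter> ball x r = {z \<in> ball x r. b \<bullet> (z - x) \<le> 0 \<and> c \<bullet> (z - x) \<le> 0}"
    using w unfolding locally_wedge_def by blast
  let ?U = "ball x r \<inter> {y. b \<bullet> (y - x) < 0} \<inter> {y. c \<bullet> (y - x) < 0}"
  have "open ?U"
    by (intro open_Int open_ball open_Collect_less continuous_intros)
  moreover have "?U \<subseteq> P \<inter> ball x r" unfolding r(2) by auto
  ultimately have "?U \<subseteq> interior P" by (intro interior_maximal) auto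
  then show ?thesis using that[of r] r(1) by blast
qed

text \<open>The information about \<open>P\<close> near an edge that the angle count needs, in Minkowski terms.  The
  vectors \<open>v\<close> and \<open>w\<close> record that the unit normals \<open>m\<close> and \<open>n\<close> of the two faces are linearly independent.\<close>

lemma edge_normals:
  assumes P: "convex_polyhedron P"
    and e: "e edge_of P" and x: "x \<in> e" "d \<noteq> 0" "x + d \<in> P" "x - d \<in> P"
  obtains m n v w r where "lorentz m m = 1" "lorentz n n = 1"
    "\<forall>z\<in>e. lorentz m (1, z) = 0 \<and> lorentz n (1, z) = 0"
    "lorentz m (0, v) = 0" "lorentz n (0, v) < 0" "lorentz n (0, w) = 0" "lorentz m (0, w) < 0"
    "dihedral_angle P e = pi - arccos (lorentz m n)"
    "r > 0" "\<forall>z\<in>ball x r. lorentz m (1, z) < 0 \<and> lorentz n (1, z) < 0 \<longrightarrow> z \<in> interior P"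
proof -
  have xP: "x \<in> P" using x(1) e edge_of_imp_subset by blast
  then have xH: "x \<in> H3" using convex_polyhedron_D[OF P] by blast
  obtain b c where w: "locally_wedge P x d b c" using edge_locally_wedge[OF P e x] .
  note W = edge_walls[OF P e x w]
  note D = locally_wedge_D[OF P xP w] and D' = locally_wedge_D[OF P xP locally_wedge_commute[OF w]]
  let ?m = "minkowski_normal x b" and ?n = "minkowski_normal x c"
  have nm: "outward_normal P (wall P x b) = ?m" using outward_normal_wall[OF P xP D(1,2) W(1)] .
  have nn: "outward_normal P (wall P x c) = ?n" using outward_normal_wall[OF P xP D'(1,2) W(2)] .
  obtain s where s: "s > 0" "?m = s *\<^sub>R (b \<bullet> x, b)" "lorentz ?m ?m = 1"
    using minkowski_normal_scale[OF xH D(1)] .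
  obtain t where t: "t > 0" "?n = t *\<^sub>R (c \<bullet> x, c)" "lorentz ?n ?n = 1"
    using minkowski_normal_scale[OF xH D'(1)] .
  obtain u v where uv: "b \<bullet> u = 0" "c \<bullet> u < 0" "c \<bullet> v = 0" "b \<bullet> v < 0"
    using w unfolding locally_wedge_def by blast
  obtain r where r: "r > 0" "\<And>z. z \<in> ball x r \<Longrightarrow> b \<bullet> (z - x) < 0 \<Longrightarrow> c \<bullet> (z - x) < 0 \<Longrightarrow> z \<in> interior P"
    using locally_wedge_interior[OF w] by metis
  have m1: "lorentz ?m (1, z) = s * (b \<bullet> (z - x))" "lorentz ?m (0, z) = s * (b \<bullet> z)" for z
    unfolding s(2) lorentz_scaleR_left lorentz_plane_vector by auto
  have n1: "lorentz ?n (1, z) = t * (c \<bullet> (z - x))" "lorentz ?n (0, z) = t * (c \<bullet> z)" for z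
    unfolding t(2) lorentz_scaleR_left lorentz_plane_vector by auto
  have all: "\<tau> = wall P x b \<or> \<tau> = wall P x c" if "\<tau> facet_of P" "e \<subseteq> \<tau>" for \<tau>
    using facet_at_wedge[OF P xP w that(1)] that(2) x(1) by blast
  have ang: "dihedral_angle P e = pi - arccos (lorentz ?m ?n)"
    unfolding dihedral_angle_def
  proof (rule the_equality)
    show "\<exists>\<sigma> \<tau>. \<sigma> facet_of P \<and> \<tau> facet_of P \<and> \<sigma> \<noteq> \<tau> \<and> e \<subseteq> \<sigma> \<and> e \<subseteq> \<tau> \<and>
        pi - arccos (lorentz ?m ?n) = pi - arccos (lorentz (outward_normal P \<sigma>) (outward_normal P \<tau>))"
      using W by (intro exI[of _ "wall P x b"] exI[of _ "wall P x c"]) (simp add: nm nn)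
  next
    fix \<theta>
    assume "\<exists>\<sigma> \<tau>. \<sigma> facet_of P \<and> \<tau> facet_of P \<and> \<sigma> \<noteq> \<tau> \<and> e \<subseteq> \<sigma> \<and> e \<subseteq> \<tau> \<and>
        \<theta> = pi - arccos (lorentz (outward_normal P \<sigma>) (outward_normal P \<tau>))"
    then obtain \<sigma> \<tau> where st: "\<sigma> facet_of P" "\<tau> facet_of P" "\<sigma> \<noteq> \<tau>" "e \<subseteq> \<sigma>" "e \<subseteq> \<tau>"
        "\<theta> = pi - arccos (lorentz (outward_normal P \<sigma>) (outward_normal P \<tau>))" by blast
    from all[OF st(1,4)] all[OF st(2,5)] st(3)
    have "\<sigma> = wall P x b \<and> \<tau> = wall P x c \<or> \<sigma> = wall P x c \<and> \<tau> = wall P x b" by blast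
    then show "\<theta> = pi - arccos (lorentz ?m ?n)"
      by (elim disjE conjE) (simp_all only: st(6) nm nn lorentz_commute)
  qed
  show ?thesis
  proof (rule that[OF s(3) t(3) _ _ _ _ _ ang r(1)])
    show "\<forall>z\<in>e. lorentz ?m (1, z) = 0 \<and> lorentz ?n (1, z) = 0"
      using W(4,5) unfolding m1 n1 wall_def by auto
    show "lorentz ?m (0, u) = 0" "lorentz ?n (0, u) < 0" "lorentz ?n (0, v) = 0" "lorentz ?m (0, v) < 0"
      unfolding m1 n1 using uv s(1) t(1) by (auto simp: mult_pos_neg)
    show "\<forall>z\<in>ball x r. lorentz ?m (1, z) < 0 \<and> lorentz ?n (1, z) < 0 \<longrightarrow> z \<in> interior P"
      unfolding m1 n1 using r(2) s(1) t(1) by (auto simp: mult_less_0_iff)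
  qed
qed

section \<open>Dihedral angles around an edge add up to at most a full turn\<close>

text \<open>Arcs on the circle are given as real intervals modulo \<open>2 * pi\<close>.  Shift them so that they start in the
  period that begins with a chosen arc \<open>u\<close>.  As they avoid the next copy of that arc, they also end in
  this period, whose length bounds the total length.\<close>

lemma disjoint_arcs_sum_le:
  fixes s t :: "'i \<Rightarrow> real"
  assumes fin: "finite I" and st: "\<And>i. i \<in> I \<Longrightarrow> s i < t i" "\<And>i. i \<in> I \<Longrightarrow> t i - s i \<le> 2 * pi"
    and disj: "\<And>i j \<phi> \<psi>. i \<in> I \<Longrightarrow> j \<in> I \<Longrightarrow> i \<noteq> j \<Longrightarrow> s i < \<phi> \<Longrightarrow> \<phi> < t i \<Longrightarrow> s j < \<psi> \<Longrightarrow> \<psi> < t j \<Longrightarrow>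
      \<not> (sin \<phi> = sin \<psi> \<and> cos \<phi> = cos \<psi>)"
  shows "(\<Sum>i\<in>I. t i - s i) \<le> 2 * pi"
proof (cases "I = {}")
  case False
  then obtain u where u: "u \<in> I" by blast
  \<comment> \<open>The number of periods by which the arc \<open>i\<close> is shifted.\<close>
  define m where "m i = \<lfloor>(s i - s u) / (2 * pi)\<rfloor>" for i
  define s' where "s' i = s i - 2 * pi * of_int (m i)" for i
  define t' where "t' i = t i - 2 * pi * of_int (m i)" for i
  have start: "s u \<le> s' i" "s' i < s u + 2 * pi" for i
  proof -
    have "of_int (m i) \<le> (s i - s u) / (2 * pi)" "(s i - s u) / (2 * pi) < of_int (m i) + 1"
      unfolding m_def by linarith+
    then have "of_int (m i) * (2 * pi) \<le> s i - s u" "s i - s u < (of_int (m i) + 1) * (2 * pi)"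
      by (simp_all only: pos_le_divide_eq pos_divide_less_eq m2pi_less_pi pi_gt_zero zero_less_mult_iff
          zero_less_numeral simp_thms)
    then show "s u \<le> s' i" "s' i < s u + 2 * pi" by (simp_all add: s'_def algebra_simps)
  qed
  have same: "sin (\<phi> + 2 * pi * of_int k) = sin \<phi> \<and> cos (\<phi> + 2 * pi * of_int k) = cos \<phi>" for \<phi> k
    using sin_cos_eq_iff[of "\<phi> + 2 * pi * of_int k" \<phi>] by blast
  have disj': False if "i \<in> I" "j \<in> I" "i \<noteq> j" "s' i < \<phi>" "\<phi> < t' i"
      "s' j + 2 * pi * of_int k < \<phi>" "\<phi> < t' j + 2 * pi * of_int k" for i j \<phi> k
  proof -
    have "s i < \<phi> + 2 * pi * of_int (m i)" "\<phi> + 2 * pi * of_int (m i) < t i"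
      "s j < \<phi> + 2 * pi * of_int (m j - k)" "\<phi> + 2 * pi * of_int (m j - k) < t j"
      using that(4-7) by (simp_all add: s'_def t'_def algebra_simps)
    from disj[OF that(1-3) this] same show False by metis
  qed
  have fine: "t' i \<le> s u + 2 * pi" if i: "i \<in> I" for i
  proof (cases "i = u")
    case True
    then show ?thesis using st(2)[OF u] by (simp add: t'_def m_def)
  next
    case False
    show ?thesis
    proof (rule ccontr)
      assume "\<not> ?thesis"
      then have "s u + 2 * pi < min (t' i) (t u + 2 * pi)" using st(1)[OF u] by simp
      then obtain \<phi> where "s u + 2 * pi < \<phi>" "\<phi> < min (t' i) (t u + 2 * pi)" using dense by blast
      moreover have "s' u = s u" "t' u = t u" by (simp_all add: s'_def t'_def m_def)
      ultimately show False using disj'[OF i u False, of \<phi> 1] start(2)[of i] by simp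
    qed
  qed
  have "(\<Sum>i\<in>I. t i - s i) = (\<Sum>i\<in>I. measure lborel {s' i<..<t' i})"
    using st(1) by (intro sum.cong refl) (simp add: s'_def t'_def less_imp_le)
  also have "\<dots> = measure lborel (\<Union>i\<in>I. {s' i<..<t' i})"
  proof (rule measure_finite_Union[symmetric, OF fin])
    show "disjoint_family_on (\<lambda>i. {s' i<..<t' i}) I"
      unfolding disjoint_family_on_def
    proof (intro ballI impI equals0I)
      fix i j \<phi> assume "i \<in> I" "j \<in> I" "i \<noteq> j" "\<phi> \<in> {s' i<..<t' i} \<inter> {s' j<..<t' j}"
      then show False using disj'[of i j \<phi> 0] by simp
    qed
  qed (auto simp: emeasure_lborel_Ioo less_imp_le st(1) s'_def t'_def)
  also have "\<dots> \<le> measure lborel {s u..s u + 2 * pi}"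
  proof (rule measure_mono_fmeasurable)
    show "(\<Union>i\<in>I. {s' i<..<t' i}) \<subseteq> {s u..s u + 2 * pi}"
    proof
      fix y assume "y \<in> (\<Union>i\<in>I. {s' i<..<t' i})"
      then obtain i where i: "i \<in> I" "s' i < y" "y < t' i" by auto
      then show "y \<in> {s u..s u + 2 * pi}" using start(1)[of i] fine[OF i(1)] by simp
    qed
    show "{s u..s u + 2 * pi} \<in> fmeasurable lborel"
      using fmeasurable_cbox[of "s u" "s u + 2 * pi"] by (simp only: cbox_interval)
  qed (auto intro: fin)
  also have "\<dots> = 2 * pi" by simp
  finally show ?thesis .
qed simp

text \<open>The half-planes with outward unit normals at angles \<open>\<alpha>\<close> and \<open>\<beta>\<close> consist of the directions at
  distance more than \<open>pi / 2\<close> from \<open>\<alpha>\<close> and from \<open>\<beta>\<close>.  If the normals enclose the angle \<open>\<delta>\<close>, the common directions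
  form an arc of length \<open>pi - \<delta>\<close>, which is the interior angle.\<close>

lemma wedge_contains_arc:
  obtains s t where "t - s = pi - arccos (cos (\<alpha> - \<beta>))"
    "\<forall>\<phi>. s < \<phi> \<longrightarrow> \<phi> < t \<longrightarrow> cos (\<phi> - \<alpha>) < 0 \<and> cos (\<phi> - \<beta>) < 0"
proof -
  define \<delta> where "\<delta> = arccos (cos (\<alpha> - \<beta>))"
  have d: "0 \<le> \<delta>" "cos \<delta> = cos (\<alpha> - \<beta>)"
    by (simp_all add: \<delta>_def arccos_lbound)
  have neg: "cos y < 0" if "pi / 2 < y" "y < 3 * pi / 2" for y
    using cos_gt_zero_pi[of "y - pi"] that by (simp add: cos_diff)
  have shift: "cos (y - 2 * n * pi) = cos y" if n: "n \<in> \<int>" for y n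
  proof -
    obtain k where "n = of_int k" using n by (rule Ints_cases)
    then show ?thesis using sin_cos_eq_iff[of y "y - 2 * n * pi"] by (auto simp: algebra_simps)
  qed
  obtain n where n: "n \<in> \<int>" "\<alpha> - \<beta> = \<delta> + 2 * n * pi \<or> \<alpha> - \<beta> = - \<delta> + 2 * n * pi"
    using d(2) cos_eq[of "\<alpha> - \<beta>" \<delta>] by metis
  from n(2) show ?thesis
  proof
    assume a: "\<alpha> - \<beta> = \<delta> + 2 * n * pi"
    show ?thesis
    proof (rule that[of "\<beta> + 3 * pi / 2" "\<beta> + \<delta> + pi / 2"])
      show "\<beta> + 3 * pi / 2 - (\<beta> + \<delta> + pi / 2) = pi - arccos (cos (\<alpha> - \<beta>))"
        unfolding \<delta>_def[symmetric] by simp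
      show "\<forall>\<phi>. \<beta> + \<delta> + pi / 2 < \<phi> \<longrightarrow> \<phi> < \<beta> + 3 * pi / 2 \<longrightarrow> cos (\<phi> - \<alpha>) < 0 \<and> cos (\<phi> - \<beta>) < 0"
      proof (intro allI impI)
        fix \<phi> assume p: "\<beta> + \<delta> + pi / 2 < \<phi>" "\<phi> < \<beta> + 3 * pi / 2"
        have e: "\<phi> - \<alpha> = (\<phi> - \<beta> - \<delta>) - 2 * n * pi" using a by linarith
        show "cos (\<phi> - \<alpha>) < 0 \<and> cos (\<phi> - \<beta>) < 0"
          unfolding e shift[OF n(1)] using neg[of "\<phi> - \<beta> - \<delta>"] neg[of "\<phi> - \<beta>"] p d(1) by auto
      qed
    qed
  next
    assume a: "\<alpha> - \<beta> = - \<delta> + 2 * n * pi"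
    show ?thesis
    proof (rule that[of "\<beta> - \<delta> + 3 * pi / 2" "\<beta> + pi / 2"])
      show "\<beta> - \<delta> + 3 * pi / 2 - (\<beta> + pi / 2) = pi - arccos (cos (\<alpha> - \<beta>))"
        unfolding \<delta>_def[symmetric] by simp
      show "\<forall>\<phi>. \<beta> + pi / 2 < \<phi> \<longrightarrow> \<phi> < \<beta> - \<delta> + 3 * pi / 2 \<longrightarrow> cos (\<phi> - \<alpha>) < 0 \<and> cos (\<phi> - \<beta>) < 0"
      proof (intro allI impI)
        fix \<phi> assume p: "\<beta> + pi / 2 < \<phi>" "\<phi> < \<beta> - \<delta> + 3 * pi / 2"
        have e: "\<phi> - \<alpha> = (\<phi> - \<beta> + \<delta>) - 2 * n * pi" using a by linarith
        show "cos (\<phi> - \<alpha>) < 0 \<and> cos (\<phi> - \<beta>) < 0"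
          unfolding e shift[OF n(1)] using neg[of "\<phi> - \<beta> + \<delta>"] neg[of "\<phi> - \<beta>"] p d(1) by auto
      qed
    qed
  qed
qed

text \<open>Around a line the directions orthogonal to it form a circle in the Lorentz complement of the tangent
  plane spanned by \<open>(1, x)\<close> and \<open>(0, d)\<close>.  This complement is Euclidean; Gram-Schmidt applied to two
  independent unit normals gives a basis.\<close>

lemma orthonormal_frame:
  assumes x: "x \<in> H3" and d: "d \<noteq> 0" and mm: "lorentz m m = 1" and nn: "lorentz n n = 1"
    and mx: "lorentz m (1, x) = 0" and nx: "lorentz n (1, x) = 0"
    and md: "lorentz m (0, d) = 0" and nd: "lorentz n (0, d) = 0"
    and mv: "lorentz m (0, v) = 0" and nv: "lorentz n (0, v) < 0"
    and nw: "lorentz n (0, w) = 0" and mw: "lorentz m (0, w) < 0"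
  obtains p q where "lorentz p p = 1" "lorentz q q = 1" "lorentz p q = 0"
    "\<forall>k. lorentz k (1, x) = 0 \<longrightarrow> lorentz k (0, d) = 0 \<longrightarrow> k = lorentz k p *\<^sub>R p + lorentz k q *\<^sub>R q"
    "\<bar>lorentz m n\<bar> < 1"
proof -
  have snd: "lorentz k (0, y) = snd k \<bullet> y" for k y by (simp add: lorentz_def)
  define \<kappa> where "\<kappa> = lorentz m n"
  define y where "y = n - \<kappa> *\<^sub>R m"
  have yn: "lorentz y (0, v) = lorentz n (0, v)" unfolding y_def lorentz_linear mv by simp
  have "lorentz (0::real \<times> point) (0, v) = 0" by (simp add: lorentz_def)
  then have y0: "y \<noteq> 0" using yn nv by auto
  have yx: "lorentz y (1, x) = 0" unfolding y_def lorentz_linear mx nx by simp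
  have "lorentz y y = 1 - \<kappa>\<^sup>2"
    unfolding y_def lorentz_linear mm nn
    by (simp add: \<kappa>_def[symmetric] lorentz_commute[of n m] power2_eq_square algebra_simps)
  then have k1: "1 - \<kappa>\<^sup>2 > 0" using orthogonal_to_timelike_pos[OF x yx y0] by simp
  define \<rho> where "\<rho> = sqrt (1 - \<kappa>\<^sup>2)"
  have \<rho>: "\<rho> > 0" "\<rho> * \<rho> = 1 - \<kappa>\<^sup>2" using k1 by (simp_all add: \<rho>_def)
  define q where "q = (1 / \<rho>) *\<^sub>R y"
  have yq: "y = \<rho> *\<^sub>R q" using \<rho>(1) by (simp add: q_def)
  have qq: "lorentz q q = 1"
    using \<open>lorentz y y = 1 - \<kappa>\<^sup>2\<close> \<rho> unfolding q_def lorentz_linear by (simp add: field_simps)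
  have mq: "lorentz m q = 0"
    unfolding q_def y_def lorentz_linear mm by (simp add: \<kappa>_def)
  have ind: "a = 0 \<and> b = 0 \<and> c = 0" if z: "a *\<^sub>R d + b *\<^sub>R v + c *\<^sub>R w = 0" for a b c
  proof -
    have "snd m \<bullet> (a *\<^sub>R d + b *\<^sub>R v + c *\<^sub>R w) = c * (snd m \<bullet> w)"
      "snd n \<bullet> (a *\<^sub>R d + b *\<^sub>R v + c *\<^sub>R w) = b * (snd n \<bullet> v)"
      using md nd mv nw unfolding snd by (simp_all add: inner_simps)
    then have "c = 0" "b = 0" using z mw nv unfolding snd by auto
    then show ?thesis using z d by simp
  qed
  have span: "k = lorentz k m *\<^sub>R m + lorentz k q *\<^sub>R q"
    if kx: "lorentz k (1, x) = 0" and kd: "lorentz k (0, d) = 0" for k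
  proof -
    define \<alpha> where "\<alpha> = lorentz k (0, w) / lorentz m (0, w)"
    define \<beta> where "\<beta> = lorentz k (0, v) / lorentz n (0, v)"
    define k' where "k' = k - \<alpha> *\<^sub>R m - \<beta> *\<^sub>R n"
    have "lorentz k' (0, d) = 0" "lorentz k' (0, v) = 0" "lorentz k' (0, w) = 0" "lorentz k' (1, x) = 0"
      unfolding k'_def lorentz_linear kd md nd mv nw kx mx nx \<alpha>_def \<beta>_def using mw nv by auto
    then have "snd k' = 0" "lorentz k' (1, x) = 0"
      using orthogonal_to_basis_imp_0[OF ind] unfolding snd by blast+
    then have "k' = 0" using orthogonal_to_timelike_eq by (metis inner_zero_left zero_prod_def)
    then have k: "k = \<alpha> *\<^sub>R m + \<beta> *\<^sub>R n" by (simp add: k'_def algebra_simps)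
    have "n = \<rho> *\<^sub>R q + \<kappa> *\<^sub>R m" using yq by (simp add: y_def algebra_simps)
    then have k2: "k = (\<alpha> + \<beta> * \<kappa>) *\<^sub>R m + (\<beta> * \<rho>) *\<^sub>R q"
      unfolding k by (simp add: algebra_simps)
    have "lorentz k m = \<alpha> + \<beta> * \<kappa>" "lorentz k q = \<beta> * \<rho>"
      unfolding k2 lorentz_linear mm mq qq lorentz_commute[of q m] by simp_all
    then show ?thesis using k2 by simp
  qed
  have "\<bar>\<kappa>\<bar> < 1" using k1 by (simp add: abs_square_less_1)
  then show ?thesis using that[of m q] mm qq mq span unfolding \<kappa>_def by blast
qed

text \<open>Positivity is the strict Cauchy-Schwarz inequality for the independent unit normals of the faces.\<close>

lemma dihedral_angle_bounds:
  assumes P: "convex_polyhedron P" and e: "e edge_of P"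
  shows "0 < dihedral_angle P e" "dihedral_angle P e \<le> pi"
proof -
  have eP: "e \<subseteq> P" using e edge_of_imp_subset by blast
  obtain x d where x: "d \<noteq> 0" "x \<in> e" "x + d \<in> e" "x - d \<in> e" using edge_has_midpoint[OF P e] .
  have xH: "x \<in> H3" using x eP convex_polyhedron_D[OF P] by blast
  have xd: "x + d \<in> P" "x - d \<in> P" using x eP by auto
  obtain m n v w r where mn: "lorentz m m = 1" "lorentz n n = 1"
    "\<forall>z\<in>e. lorentz m (1, z) = 0 \<and> lorentz n (1, z) = 0"
    and vw: "lorentz m (0, v) = 0" "lorentz n (0, v) < 0" "lorentz n (0, w) = 0" "lorentz m (0, w) < 0"
    and ang: "dihedral_angle P e = pi - arccos (lorentz m n)"
    by (rule edge_normals[OF P e x(2,1) xd]) (rule that)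
  have zero: "lorentz k (0, d) = 0" if "lorentz k (1, x) = 0" "lorentz k (1, x + d) = 0" for k
    using that by (simp add: lorentz_def inner_add_right)
  have mx: "lorentz m (1, x) = 0" "lorentz m (1, x + d) = 0" "lorentz n (1, x) = 0" "lorentz n (1, x + d) = 0"
    using mn(3) x by blast+
  have "\<bar>lorentz m n\<bar> < 1"
    by (rule orthonormal_frame[OF xH x(1) mn(1,2) mx(1,3) zero[OF mx(1,2)] zero[OF mx(3,4)] vw])
  then have "0 < arccos (lorentz m n)" "arccos (lorentz m n) < pi"
    using arccos_lt_bounded[of "lorentz m n"] by auto
  then show "0 < dihedral_angle P e" "dihedral_angle P e \<le> pi" using ang by simp_all
qed

text \<open>The affine point on the ray through \<open>(1, x) + \<tau> u\<close>.  For a tangent vector \<open>u\<close> at \<open>x\<close> this is a curve that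
  leaves \<open>x\<close> in the direction \<open>u\<close>.\<close>

definition ray_point :: "point \<Rightarrow> real \<times> point \<Rightarrow> real \<Rightarrow> point" where
  "ray_point x u \<tau> = (1 / fst ((1, x) + \<tau> *\<^sub>R u)) *\<^sub>R snd ((1, x) + \<tau> *\<^sub>R u)"

context kleinian
begin

lemma lifts_to_inverse:
  assumes h: "h \<in> G" and K: "lifts_to h K" and M: "lifts_to (inverse_map h) M"
  shows "M (K z) = z"
proof -
  have lin: "linear (\<lambda>z. M (K z))"
    using linear_compose[OF lifts_to_D(1)[OF K] lifts_to_D(1)[OF M]] by (simp add: o_def)
  have "M (K z) = id z"
  proof (rule linear_eq_on_span[OF lin linear_id, of "lift ` H3"])
    fix y assume "y \<in> lift ` H3"
    then obtain x where x: "x \<in> H3" "y = lift x" by (rule imageE)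
    then show "M (K y) = id y"
      using lifts_to_D(3)[OF K x(1)] lifts_to_D(3)[OF M maps_H3[OF h x(1)]] inverse_left[OF h x(1)]
      by simp
  next
    show "z \<in> span (lift ` H3)" unfolding span_lift_H3 by (rule UNIV_I)
  qed
  then show ?thesis by simp
qed

lemma inverse_map_inj:
  assumes h: "h \<in> G" and k: "k \<in> G" and eq: "inverse_map h = inverse_map k"
  shows "h = k"
proof (rule eqI[OF h k])
  fix x assume x: "x \<in> H3"
  have "h x = h (inverse_map h (k x))" by (simp only: eq inverse_left[OF k x])
  also have "\<dots> = k x" using inverse_right[OF h maps_H3[OF k x]] .
  finally show "h x = k x" .
qed

text \<open>The image of the curve under \<open>h\<close> starts at \<open>h x\<close>, on both walls.  Since the lift \<open>K\<close> of \<open>h\<close> is linear, the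
  signs of the products of \<open>K u\<close> with the wall normals decide on which sides it continues.\<close>

lemma ray_enters_wedge:
  assumes h: "h \<in> G" and x: "x \<in> H3" and K: "lifts_to h K"
    and m: "lorentz m (1, h x) = 0" "lorentz m (K u) < 0"
    and n: "lorentz n (1, h x) = 0" "lorentz n (K u) < 0"
    and r: "r > 0" "\<forall>z\<in>ball (h x) r. lorentz m (1, z) < 0 \<and> lorentz n (1, z) < 0 \<longrightarrow> z \<in> interior P"
  shows "eventually (\<lambda>\<tau>. ray_point x u \<tau> \<in> H3 \<and> h (ray_point x u \<tau>) \<in> interior P) (at_right 0)"
proof -
  have lin: "linear K" using lifts_to_D(1)[OF K] .
  let ?y = "ray_point x u"
  have lim: "(?y \<longlongrightarrow> x) (at_right 0)"
  proof -
    have "(?y \<longlongrightarrow> (1 / fst ((1, x) + 0 *\<^sub>R u)) *\<^sub>R snd ((1, x) + 0 *\<^sub>R u)) (at_right 0)"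
      unfolding ray_point_def by (intro tendsto_intros) auto
    then show ?thesis by simp
  qed
  have f0: "((\<lambda>\<tau>. fst ((1, x) + \<tau> *\<^sub>R u)) \<longlongrightarrow> fst ((1, x) + 0 *\<^sub>R u)) (at_right 0)"
    by (intro tendsto_intros)
  have e1: "eventually (\<lambda>\<tau>. fst ((1, x) + \<tau> *\<^sub>R u) > 0) (at_right 0)"
    using order_tendstoD(1)[OF f0, of 0] by simp
  have e2: "eventually (\<lambda>\<tau>. ?y \<tau> \<in> H3) (at_right 0)"
    using topological_tendstoD[OF lim open_ball x] .
  have "isCont h x"
    using continuous[OF h] x open_ball continuous_on_eq_continuous_at by blast
  then have "((\<lambda>\<tau>. h (?y \<tau>)) \<longlongrightarrow> h x) (at_right 0)"
    using lim isCont_tendsto_compose by blast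
  then have e3: "eventually (\<lambda>\<tau>. h (?y \<tau>) \<in> ball (h x) r) (at_right 0)"
    using r(1) by (intro topological_tendstoD[OF _ open_ball]) auto
  have e4: "eventually (\<lambda>\<tau>. \<tau> > (0::real)) (at_right 0)" by (rule eventually_at_right_less)
  have neg: "lorentz k (1, h (?y \<tau>)) < 0"
    if k: "lorentz k (1, h x) = 0" "lorentz k (K u) < 0"
      and \<tau>: "\<tau> > 0" "fst ((1, x) + \<tau> *\<^sub>R u) > 0" "?y \<tau> \<in> H3" for k \<tau>
  proof -
    define f where "f = fst ((1, x) + \<tau> *\<^sub>R u)"
    have f: "f > 0" using \<tau>(2) by (simp add: f_def)
    have "(1, x) + \<tau> *\<^sub>R u = f *\<^sub>R (1, ?y \<tau>)"
      using f by (simp add: ray_point_def f_def[symmetric] prod_eq_iff, simp add: f_def)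
    then have "K (1, x) + \<tau> *\<^sub>R K u = f *\<^sub>R K (1, ?y \<tau>)"
      by (metis linear_add[OF lin] linear_scale[OF lin])
    moreover obtain c where c: "c > 0" "K (1, ?y \<tau>) = c *\<^sub>R (1, h (?y \<tau>))"
      using lifts_to_projective[OF K \<tau>(3) maps_H3[OF h \<tau>(3)]] .
    moreover obtain c' where c': "c' > 0" "K (1, x) = c' *\<^sub>R (1, h x)"
      using lifts_to_projective[OF K x maps_H3[OF h x]] .
    ultimately have "lorentz k (c' *\<^sub>R (1, h x) + \<tau> *\<^sub>R K u) = lorentz k (f *\<^sub>R c *\<^sub>R (1, h (?y \<tau>)))"
      by simp
    then have "\<tau> * lorentz k (K u) = (f * c) * lorentz k (1, h (?y \<tau>))"
      unfolding lorentz_add_right lorentz_scaleR_right k(1) by simp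
    moreover have "\<tau> * lorentz k (K u) < 0" using k(2) \<tau>(1) by (simp add: mult_pos_neg)
    moreover have "f * c > 0" using f c(1) by simp
    ultimately show ?thesis by (metis mult_less_0_iff less_asym)
  qed
  from e1 e2 e3 e4 show ?thesis
  proof eventually_elim
    case (elim \<tau>)
    then show ?case using r(2) neg[OF m] neg[OF n] by blast
  qed
qed

text \<open>Let \<open>u\<close> run through the unit vectors of the plane spanned by \<open>p\<close> and \<open>q\<close>.  The directions \<open>u\<close> that lead
  into the tile \<open>h\<^sup>-\<^sup>1 P\<close> contain an arc whose length is the dihedral angle of \<open>P\<close> at \<open>h ` e\<close>: the inverse of
  the lift of \<open>h\<close> is a Lorentz map, so it carries the outward normals of \<open>P\<close> at \<open>h ` e\<close> to unit vectors of
  that plane that enclose the same angle.\<close>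

lemma tile_contains_arc:
  assumes P: "convex_polyhedron P" and eP: "e \<subseteq> H3"
    and x: "d \<noteq> 0" "x \<in> e" "x + d \<in> e" "x - d \<in> e"
    and pp: "lorentz p p = 1" and qq: "lorentz q q = 1" and pq: "lorentz p q = 0"
    and frame: "\<forall>k. lorentz k (1, x) = 0 \<longrightarrow> lorentz k (0, d) = 0 \<longrightarrow>
      k = lorentz k p *\<^sub>R p + lorentz k q *\<^sub>R q"
    and h: "h \<in> G" and he: "h ` e edge_of P"
  obtains s t where "s < t" "t - s = dihedral_angle P (h ` e)" "t - s \<le> 2 * pi"
    "\<forall>\<phi>. s < \<phi> \<longrightarrow> \<phi> < t \<longrightarrow> eventually (\<lambda>\<tau>. ray_point x (cos \<phi> *\<^sub>R p + sin \<phi> *\<^sub>R q) \<tau> \<in> H3 \<and>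
      h (ray_point x (cos \<phi> *\<^sub>R p + sin \<phi> *\<^sub>R q) \<tau>) \<in> interior P) (at_right 0)"
proof -
  have xH: "x \<in> H3" "x + d \<in> H3" "x - d \<in> H3" using x eP by auto
  have PH: "P \<subseteq> H3" using convex_polyhedron_D[OF P] by blast
  have heP: "h ` e \<subseteq> P" using he edge_of_imp_subset by blast
  \<comment> \<open>\<open>h x\<close> lies strictly between two points of the edge \<open>h ` e\<close>, though not necessarily at their midpoint.\<close>
  have "x \<in> open_segment (x - d) (x + d)"
    using midpoint_in_open_segment[of "x - d" "x + d"] opposite_ne[OF x(1), of x]
    by (simp add: midpoint_def scaleR_2[symmetric])
  from image_open_segment[OF h xH(3,2) this]
  have seg: "h x \<in> open_segment (h (x - d)) (h (x + d))" .
  have cv: "convex (h ` e)" using he face_of_imp_convex by (auto simp: edge_of_def)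
  obtain d' where d': "d' \<noteq> 0" "h x + d' \<in> h ` e" "h x - d' \<in> h ` e"
  proof -
    obtain l where l: "0 < l" "l < 1" "h x = (1 - l) *\<^sub>R h (x - d) + l *\<^sub>R h (x + d)"
      and ne: "h (x - d) \<noteq> h (x + d)"
      using seg by (auto simp: in_segment)
    define j where "j = min l (1 - l)"
    define d' where "d' = j *\<^sub>R (h (x + d) - h (x - d))"
    have "(1 - a) *\<^sub>R h (x - d) + a *\<^sub>R h (x + d) \<in> h ` e" if "0 \<le> a" "a \<le> 1" for a
      using that x by (intro convexD_alt[OF cv]) auto
    from this[of "l + j"] this[of "l - j"]
    have "h x + d' \<in> h ` e" "h x - d' \<in> h ` e"
      using l(1,2) unfolding l(3) d'_def by (auto simp: j_def algebra_simps min_def split: if_splits)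
    moreover have "d' \<noteq> 0" using ne l(1,2) by (simp add: d'_def j_def)
    ultimately show ?thesis by (rule that[rotated])
  qed
  have hx: "h x \<in> h ` e" using x(2) by blast
  obtain m n v w r where mn: "lorentz m m = 1" "lorentz n n = 1"
    "\<forall>z\<in>h ` e. lorentz m (1, z) = 0 \<and> lorentz n (1, z) = 0"
    and vw: "lorentz m (0, v) = 0" "lorentz n (0, v) < 0" "lorentz n (0, w) = 0" "lorentz m (0, w) < 0"
    and ang: "dihedral_angle P (h ` e) = pi - arccos (lorentz m n)"
    and r: "r > 0" "\<forall>z\<in>ball (h x) r. lorentz m (1, z) < 0 \<and> lorentz n (1, z) < 0 \<longrightarrow> z \<in> interior P"
    by (rule edge_normals[OF P he hx d'(1) subsetD[OF heP d'(2)] subsetD[OF heP d'(3)]]) (rule that)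
  obtain K where K: "lifts_to h K" using obtain_lift[OF h] .
  obtain M where M: "lifts_to (inverse_map h) M" using obtain_lift[OF inverse_in[OF h]] .
  have adj: "lorentz k (K z) = lorentz (M k) z" for k z
    using lifts_to_D(2)[OF M, of k "K z"] lifts_to_inverse[OF h K M] by simp
  have zero: "lorentz (M k) (1, z) = 0" if k: "\<forall>z\<in>h ` e. lorentz k (1, z) = 0" and z: "z \<in> e" for k z
  proof -
    have zH: "z \<in> H3" using z eP by blast
    obtain c where "K (1, z) = c *\<^sub>R (1, h z)" using lifts_to_projective[OF K zH maps_H3[OF h zH]] by metis
    then show ?thesis using k z unfolding adj[symmetric] by (simp add: lorentz_scaleR_right del: scaleR_Pair)
  qed
  have angle: "\<exists>\<alpha>. M k = cos \<alpha> *\<^sub>R p + sin \<alpha> *\<^sub>R q"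
    if k: "\<forall>z\<in>h ` e. lorentz k (1, z) = 0" and kk: "lorentz k k = 1" for k
  proof -
    have 1: "lorentz (M k) (1, x) = 0" using zero[OF k x(2)] .
    have "lorentz (M k) (0, d) = lorentz (M k) (1, x + d) - lorentz (M k) (1, x)"
      unfolding lorentz_diff_right[symmetric] by simp
    then have 2: "lorentz (M k) (0, d) = 0" using 1 zero[OF k x(3)] by simp
    define a b where "a = lorentz (M k) p" and "b = lorentz (M k) q"
    have Mk: "M k = a *\<^sub>R p + b *\<^sub>R q" using frame 1 2 unfolding a_def b_def by blast
    have "lorentz (M k) (M k) = 1" using lifts_to_D(2)[OF M] kk by simp
    moreover have "lorentz (M k) (M k) = a\<^sup>2 + b\<^sup>2"
      unfolding Mk lorentz_linear pp qq pq lorentz_commute[of q p] by (simp add: power2_eq_square)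
    ultimately have "a\<^sup>2 + b\<^sup>2 = 1" by simp
    then obtain \<alpha> where "a = cos \<alpha>" "b = sin \<alpha>" using sincos_total_2pi by metis
    then show ?thesis using Mk by blast
  qed
  obtain \<alpha> where \<alpha>: "M m = cos \<alpha> *\<^sub>R p + sin \<alpha> *\<^sub>R q" using angle[of m] mn by blast
  obtain \<beta> where \<beta>: "M n = cos \<beta> *\<^sub>R p + sin \<beta> *\<^sub>R q" using angle[of n] mn by blast
  have inner: "lorentz (cos a *\<^sub>R p + sin a *\<^sub>R q) (cos b *\<^sub>R p + sin b *\<^sub>R q) = cos (b - a)" for a b
    unfolding lorentz_linear pp qq pq lorentz_commute[of q p] by (simp add: cos_diff)
  have "lorentz m n = cos (\<alpha> - \<beta>)"
    using lifts_to_D(2)[OF M, of m n] inner[of \<beta> \<alpha>] lorentz_commute unfolding \<alpha> \<beta> by metis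
  then obtain s t where st: "t - s = pi - arccos (lorentz m n)"
    "\<forall>\<phi>. s < \<phi> \<longrightarrow> \<phi> < t \<longrightarrow> cos (\<phi> - \<alpha>) < 0 \<and> cos (\<phi> - \<beta>) < 0"
    using wedge_contains_arc[of \<alpha> \<beta>] by metis
  show ?thesis
  proof (rule that[of s t])
    show "s < t" "t - s = dihedral_angle P (h ` e)" "t - s \<le> 2 * pi"
      using st(1) ang dihedral_angle_bounds[OF P he] by linarith+
    show "\<forall>\<phi>. s < \<phi> \<longrightarrow> \<phi> < t \<longrightarrow> eventually (\<lambda>\<tau>. ray_point x (cos \<phi> *\<^sub>R p + sin \<phi> *\<^sub>R q) \<tau> \<in> H3 \<and>
      h (ray_point x (cos \<phi> *\<^sub>R p + sin \<phi> *\<^sub>R q) \<tau>) \<in> interior P) (at_right 0)"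
    proof (intro allI impI)
      fix \<phi> assume "s < \<phi>" "\<phi> < t"
      then have neg: "cos (\<phi> - \<alpha>) < 0" "cos (\<phi> - \<beta>) < 0" using st(2) by blast+
      let ?u = "cos \<phi> *\<^sub>R p + sin \<phi> *\<^sub>R q"
      have "lorentz m (1, h x) = 0" "lorentz n (1, h x) = 0" using mn(3) hx by blast+
      moreover have "lorentz m (K ?u) < 0" "lorentz n (K ?u) < 0"
        unfolding adj \<alpha> \<beta> inner using neg by auto
      ultimately show "eventually (\<lambda>\<tau>. ray_point x ?u \<tau> \<in> H3 \<and> h (ray_point x ?u \<tau>) \<in> interior P) (at_right 0)"
        using ray_enters_wedge[OF h xH(1) K _ _ _ _ r] by blast
    qed
  qed
qed

text \<open>Every \<open>h\<close> in \<open>K\<close> gives a tile \<open>h\<^sup>-\<^sup>1 P\<close> that contains \<open>e\<close>.  Different tiles have disjoint interiors, so their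
  arcs of directions around \<open>e\<close> are disjoint arcs of one circle.\<close>

lemma sum_dihedral_angles_le:
  assumes P: "convex_polyhedron P"
    and disj: "\<And>h k. h \<in> G \<Longrightarrow> k \<in> G \<Longrightarrow> h \<noteq> k \<Longrightarrow> interior (h ` P) \<inter> interior (k ` P) = {}"
    and e: "e edge_of P" and fin: "finite K" and KG: "K \<subseteq> G"
    and Ke: "\<And>h. h \<in> K \<Longrightarrow> h ` e edge_of P"
  shows "(\<Sum>h\<in>K. dihedral_angle P (h ` e)) \<le> 2 * pi"
proof -
  have PH: "P \<subseteq> H3" using convex_polyhedron_D[OF P] by blast
  have eP: "e \<subseteq> P" using e edge_of_imp_subset by blast
  then have eH: "e \<subseteq> H3" using PH by blast
  obtain x d where x: "d \<noteq> 0" "x \<in> e" "x + d \<in> e" "x - d \<in> e" using edge_has_midpoint[OF P e] .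
  have xH: "x \<in> H3" using x eH by blast
  have xd: "x + d \<in> P" "x - d \<in> P" using x eP by auto
  obtain m n v w r where mn: "lorentz m m = 1" "lorentz n n = 1"
    "\<forall>z\<in>e. lorentz m (1, z) = 0 \<and> lorentz n (1, z) = 0"
    and vw: "lorentz m (0, v) = 0" "lorentz n (0, v) < 0" "lorentz n (0, w) = 0" "lorentz m (0, w) < 0"
    by (rule edge_normals[OF P e x(2,1) xd]) (rule that)
  have zero: "lorentz k (0, d) = 0" if "lorentz k (1, x) = 0" "lorentz k (1, x + d) = 0" for k
    using that by (simp add: lorentz_def inner_add_right)
  have mx: "lorentz m (1, x) = 0" "lorentz m (1, x + d) = 0" "lorentz n (1, x) = 0" "lorentz n (1, x + d) = 0"
    using mn(3) x by blast+
  obtain p q where pq: "lorentz p p = 1" "lorentz q q = 1" "lorentz p q = 0"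
    and frame: "\<forall>k. lorentz k (1, x) = 0 \<longrightarrow> lorentz k (0, d) = 0 \<longrightarrow>
      k = lorentz k p *\<^sub>R p + lorentz k q *\<^sub>R q"
    by (rule orthonormal_frame[OF xH x(1) mn(1,2) mx(1,3) zero[OF mx(1,2)] zero[OF mx(3,4)] vw]) (rule that)
  define u where "u \<phi> = cos \<phi> *\<^sub>R p + sin \<phi> *\<^sub>R q" for \<phi>
  define arc where "arc h s t \<longleftrightarrow> s < t \<and> t - s = dihedral_angle P (h ` e) \<and> t - s \<le> 2 * pi \<and>
    (\<forall>\<phi>. s < \<phi> \<longrightarrow> \<phi> < t \<longrightarrow> eventually (\<lambda>\<tau>. ray_point x (u \<phi>) \<tau> \<in> H3 \<and>
      h (ray_point x (u \<phi>) \<tau>) \<in> interior P) (at_right 0))" for h s t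
  have "\<exists>s t. arc h s t" if hK: "h \<in> K" for h
  proof -
    have "h \<in> G" using hK KG by blast
    from tile_contains_arc[OF P eH x pq frame this Ke[OF hK]] obtain s t where
      "s < t" "t - s = dihedral_angle P (h ` e)" "t - s \<le> 2 * pi"
      "\<forall>\<phi>. s < \<phi> \<longrightarrow> \<phi> < t \<longrightarrow> eventually (\<lambda>\<tau>. ray_point x (u \<phi>) \<tau> \<in> H3 \<and>
        h (ray_point x (u \<phi>) \<tau>) \<in> interior P) (at_right 0)"
      unfolding u_def .
    then have "arc h s t" unfolding arc_def by (intro conjI)
    then show ?thesis by blast
  qed
  then obtain s t where st: "\<And>h. h \<in> K \<Longrightarrow> arc h (s h) (t h)" by metis
  have "(\<Sum>h\<in>K. dihedral_angle P (h ` e)) = (\<Sum>h\<in>K. t h - s h)"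
    using st unfolding arc_def by (intro sum.cong refl) metis
  also have "\<dots> \<le> 2 * pi"
  proof (rule disjoint_arcs_sum_le[OF fin])
    show "s h < t h" "t h - s h \<le> 2 * pi" if "h \<in> K" for h using st[OF that] unfolding arc_def by blast+
    fix h k \<phi> \<psi>
    assume hk: "h \<in> K" "k \<in> K" "h \<noteq> k" and \<phi>: "s h < \<phi>" "\<phi> < t h" and \<psi>: "s k < \<psi>" "\<psi> < t k"
    show "\<not> (sin \<phi> = sin \<psi> \<and> cos \<phi> = cos \<psi>)"
    proof
      assume "sin \<phi> = sin \<psi> \<and> cos \<phi> = cos \<psi>"
      then have u: "u \<phi> = u \<psi>" by (simp add: u_def)
      have "eventually (\<lambda>\<tau>. ray_point x (u \<phi>) \<tau> \<in> H3 \<and> h (ray_point x (u \<phi>) \<tau>) \<in> interior P) (at_right 0)"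
        using st[OF hk(1)] \<phi> unfolding arc_def by blast
      moreover have "eventually (\<lambda>\<tau>. ray_point x (u \<phi>) \<tau> \<in> H3 \<and> k (ray_point x (u \<phi>) \<tau>) \<in> interior P) (at_right 0)"
        using st[OF hk(2)] \<psi> unfolding u arc_def by blast
      ultimately have "eventually (\<lambda>\<tau>. \<exists>y\<in>H3. h y \<in> interior P \<and> k y \<in> interior P) (at_right (0::real))"
        by eventually_elim blast
      then have "\<exists>y\<in>H3. h y \<in> interior P \<and> k y \<in> interior P"
        by (simp add: eventually_const_iff trivial_limit_at_right_real)
      then obtain y where y: "y \<in> H3" "h y \<in> interior P" "k y \<in> interior P" by blast
      have G: "h \<in> G" "k \<in> G" using hk KG by blast+
      have "y \<in> interior (inverse_map a ` P)" if "a \<in> G" "a y \<in> interior P" for a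
      proof -
        have "inverse_map a (a y) \<in> inverse_map a ` interior P" using that(2) by (rule imageI)
        then have "inverse_map a (a y) \<in> interior (inverse_map a ` P)"
          using image_interior[OF inverse_in[OF that(1)] PH] by blast
        then show ?thesis by (simp only: inverse_left[OF that(1) y(1)])
      qed
      then have "y \<in> interior (inverse_map h ` P) \<inter> interior (inverse_map k ` P)" using G y by blast
      moreover have "inverse_map h \<noteq> inverse_map k"
        using hk(3) inverse_map_inj[OF G] by blast
      ultimately show False using disj[OF inverse_in inverse_in, OF G] by blast
    qed
  qed
  finally show ?thesis .
qed

end

section \<open>Tiles around interior points of facets\<close>

lemma open_segment_to_interior:
  fixes S :: "'a::euclidean_space set"
  assumes "convex S" "y \<in> S" "q \<in> interior S" "z \<in> open_segment y q"
  shows "z \<in> interior S"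
  using in_interior_closure_convex_segment[OF assms(1,3), of y] closure_subset[of S] assms(2,4)
    open_segment_commute[of q y] by auto

context kleinian
begin

lemma fixes_line:
  assumes h: "h \<in> G" and a: "a \<in> H3" "h a = a" and b: "b \<in> H3" "h b = b"
    and c: "c \<in> H3" "c = (1 - t) *\<^sub>R a + t *\<^sub>R b"
  shows "h c = c"
proof -
  obtain L where L: "lifts_to h L" using obtain_lift[OF h] .
  have lin: "linear L" using lifts_to_D(1)[OF L] .
  have "L (1, a) = (1, a)" "L (1, b) = (1, b)"
    using lifts_to_fixed[OF L a(1) maps_H3[OF h a(1)]] lifts_to_fixed[OF L b(1) maps_H3[OF h b(1)]] a b
    by auto
  moreover have "(1, c) = (1 - t) *\<^sub>R (1, a) + t *\<^sub>R (1, b)" by (simp add: c(2))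
  ultimately have "L (1, c) = (1, c)" by (metis linear_add[OF lin] linear_scale[OF lin])
  then show ?thesis using lifts_to_fixed[OF L c(1) maps_H3[OF h c(1)]] by simp
qed

context
  fixes P :: "point set"
  assumes P: "convex_polyhedron P"
    and disj: "\<And>h k. h \<in> G \<Longrightarrow> k \<in> G \<Longrightarrow> h \<noteq> k \<Longrightarrow> interior (h ` P) \<inter> interior (k ` P) = {}"
begin

lemmas P_H3 = convex_polyhedron_D(1)[OF P]

lemma one_image: "\<one>\<^bsub>BijGroup H3\<^esub> ` P = P"
  using one_apply P_H3 by (auto simp: subset_iff image_iff simp del: mem_ball_0)

lemma disjoint_from_P: "h \<in> G \<Longrightarrow> h \<noteq> \<one>\<^bsub>BijGroup H3\<^esub> \<Longrightarrow> interior (h ` P) \<inter> interior P = {}"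
  using disj[OF _ one_in] one_image by metis

lemma tile_interior_nonempty: "h \<in> G \<Longrightarrow> interior (h ` P) \<noteq> {}"
  using image_interior[OF _ P_H3, of h] convex_polyhedron_D(2)[OF P] by blast

text \<open>A tile at \<open>x\<close> other than \<open>P\<close> cannot have interior points on the inner side of the wall, because segments
  from them to \<open>x\<close> would enter \<open>P\<close>; its interior is open, so it cannot lie in the wall either.\<close>

lemma tile_beyond_wall:
  assumes w: "locally_halfspace P x b" and h: "h \<in> G" "h \<noteq> \<one>\<^bsub>BijGroup H3\<^esub>" and x: "x \<in> h ` P"
  obtains q where "q \<in> interior (h ` P)" "b \<bullet> (q - x) > 0"
proof -
  let ?T = "h ` P"
  have cv: "convex ?T" using convex_image[OF h(1) P_H3 convex_polyhedron_D(3)[OF P]] .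
  obtain r where b: "b \<noteq> 0" and r: "r > 0" "P \<inter> ball x r = {z \<in> ball x r. b \<bullet> (z - x) \<le> 0}"
    using w unfolding locally_halfspace_def by blast
  have int: "z \<in> interior P" if "z \<in> ball x r" "b \<bullet> (z - x) < 0" for z
  proof -
    have "open (ball x r \<inter> {z. b \<bullet> (z - x) < 0})"
      by (intro open_Int open_ball open_Collect_less continuous_intros)
    moreover have "ball x r \<inter> {z. b \<bullet> (z - x) < 0} \<subseteq> P \<inter> ball x r" unfolding r(2) by auto
    ultimately have "ball x r \<inter> {z. b \<bullet> (z - x) < 0} \<subseteq> interior P" by (intro interior_maximal) auto
    then show ?thesis using that by blast
  qed
  have nn: "b \<bullet> (q - x) \<ge> 0" if q: "q \<in> interior ?T" for q
  proof (rule ccontr)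
    assume "\<not> ?thesis"
    then have neg: "b \<bullet> (q - x) < 0" by simp
    then have "q \<noteq> x" by auto
    obtain t where t: "t > 0" "t \<le> 1" "\<And>s. \<bar>s\<bar> \<le> t \<Longrightarrow> x + s *\<^sub>R (q - x) \<in> ball x r"
      using small_step[OF r(1)] by metis
    define y where "y = x + (t / 2) *\<^sub>R (q - x)"
    have "y \<in> ball x r" "b \<bullet> (y - x) < 0" using t neg by (auto simp: y_def mult_pos_neg)
    then have "y \<in> interior P" by (rule int)
    moreover have "y \<in> open_segment x q"
      unfolding in_segment using \<open>q \<noteq> x\<close> t
      by (intro conjI exI[of _ "t / 2"]) (auto simp: y_def algebra_simps)
    then have "y \<in> interior ?T"
      by (rule open_segment_to_interior[OF cv x q])
    ultimately show False using disjoint_from_P[OF h] by blast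
  qed
  obtain q where q: "q \<in> interior ?T" using tile_interior_nonempty[OF h(1)] by blast
  obtain s where s: "s > 0" "ball q s \<subseteq> interior ?T" using q by (metis open_interior open_contains_ball)
  obtain t where t: "t > 0" "\<And>a. \<bar>a\<bar> \<le> t \<Longrightarrow> q + a *\<^sub>R b \<in> ball q s"
    using small_step[OF s(1)] by metis
  have "q + t *\<^sub>R b \<in> interior ?T" using t s by auto
  moreover have "b \<bullet> (q + t *\<^sub>R b - x) > 0"
  proof -
    have "b \<bullet> (q + t *\<^sub>R b - x) = b \<bullet> (q - x) + t * (b \<bullet> b)" by (simp add: inner_simps)
    moreover have "t * (b \<bullet> b) > 0" using t(1) b by simp
    ultimately show ?thesis using nn[OF q] by linarith
  qed
  ultimately show ?thesis by (rule that)
qed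

text \<open>By convexity a tile that contains the facet contains, near \<open>x\<close>, everything beyond it: the segments
  from an interior point \<open>q\<close> to points of the facet sweep out all short segments from \<open>x\<close> to points
  \<open>q'\<close> beyond the wall.  So no second tile has room there.\<close>

lemma only_tile_beyond_wall:
  assumes w: "locally_halfspace P x b"
    and h: "h \<in> G" "h \<noteq> \<one>\<^bsub>BijGroup H3\<^esub>" "wall P x b \<subseteq> h ` P" "x \<in> P"
    and k: "k \<in> G" "k \<noteq> \<one>\<^bsub>BijGroup H3\<^esub>" "x \<in> k ` P"
  shows "h = k"
proof (rule ccontr)
  assume ne: "h \<noteq> k"
  obtain r where b: "b \<noteq> 0" and r: "r > 0" "P \<inter> ball x r = {z \<in> ball x r. b \<bullet> (z - x) \<le> 0}"
    using w unfolding locally_halfspace_def by blast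
  have cvh: "convex (h ` P)" using convex_image[OF h(1) P_H3 convex_polyhedron_D(3)[OF P]] .
  have cvk: "convex (k ` P)" using convex_image[OF k(1) P_H3 convex_polyhedron_D(3)[OF P]] .
  have "x \<in> h ` P" using h(3,4) by (auto simp: wall_def)
  then obtain q where q: "q \<in> interior (h ` P)" "b \<bullet> (q - x) > 0" using tile_beyond_wall[OF w h(1,2)] by blast
  obtain q' where q': "q' \<in> interior (k ` P)" "b \<bullet> (q' - x) > 0" using tile_beyond_wall[OF w k] by blast
  \<comment> \<open>The vector \<open>v\<close> below is the projection of \<open>q' - x\<close> to the wall along \<open>q - x\<close>.\<close>
  define \<rho> where "\<rho> = (b \<bullet> (q' - x)) / (b \<bullet> (q - x))"
  have \<rho>: "\<rho> > 0" "b \<bullet> (q' - x) = \<rho> * (b \<bullet> (q - x))" using q q' by (auto simp: \<rho>_def)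
  define v where "v = (q' - x) - \<rho> *\<^sub>R (q - x)"
  have bv: "b \<bullet> v = 0" using \<rho>(2) by (simp add: v_def inner_diff_right)
  obtain \<eta> where \<eta>: "\<eta> > 0" "\<eta> \<le> 1" "\<And>s. \<bar>s\<bar> \<le> \<eta> \<Longrightarrow> x + s *\<^sub>R v \<in> ball x r"
    using small_step[OF r(1)] by metis
  define y where "y = x + \<eta> *\<^sub>R v"
  have "y \<in> {z \<in> ball x r. b \<bullet> (z - x) \<le> 0}" using \<eta> bv by (simp add: y_def)
  then have "y \<in> P" using r(2) by blast
  then have y: "y \<in> h ` P" "b \<bullet> (y - x) = 0" using h(3) bv by (auto simp: wall_def y_def)
  \<comment> \<open>The weights make the point \<open>z\<close> of the segment from \<open>y\<close> to \<open>q\<close> lie on the ray from \<open>x\<close> to \<open>q'\<close>.\<close>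
  define c where "c = \<eta> * \<rho>"
  have c: "c > 0" unfolding c_def using \<eta>(1) \<rho>(1) by (rule mult_pos_pos)
  define D where "D = 1 + c"
  have D: "D > 1" using c by (simp add: D_def)
  define s where "s = c / D"
  have s: "0 < s" "s < 1" "1 - s = 1 / D" using c by (simp_all add: s_def D_def field_simps)
  define z where "z = (1 - s) *\<^sub>R y + s *\<^sub>R q"
  have "y \<noteq> q" using y(2) q(2) by auto
  then have "z \<in> open_segment y q" using s by (auto simp: in_segment z_def)
  then have zh: "z \<in> interior (h ` P)"
    by (rule open_segment_to_interior[OF cvh y(1) q(1)])
  have Ds: "D * (1 - s) = 1" "D * s = c" using D unfolding s(3) by (simp_all add: s_def)
  have "D *\<^sub>R z = y + c *\<^sub>R q"
    unfolding z_def scaleR_add_right scaleR_scaleR Ds by simp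
  also have "\<dots> = D *\<^sub>R x + \<eta> *\<^sub>R (q' - x)"
    by (simp add: y_def v_def D_def c_def algebra_simps)
  finally have "(1 / D) *\<^sub>R (D *\<^sub>R z) = (1 / D) *\<^sub>R (D *\<^sub>R x + \<eta> *\<^sub>R (q' - x))" by simp
  then have zx: "z = x + (\<eta> / D) *\<^sub>R (q' - x)" using D by (simp add: scaleR_add_right)
  have "q' \<noteq> x" using q'(2) by auto
  moreover have "0 < \<eta> / D" "\<eta> / D < 1" using \<eta> D by (auto simp: divide_simps)
  moreover have "z = (1 - \<eta> / D) *\<^sub>R x + (\<eta> / D) *\<^sub>R q'" unfolding zx by (simp add: algebra_simps)
  ultimately have "z \<in> open_segment x q'" unfolding in_segment by blast
  then have "z \<in> interior (k ` P)"
    by (rule open_segment_to_interior[OF cvk k(3) q'(1)])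
  then show False using disj[OF h(1) k(1) ne] zh by blast
qed

lemma countable_G: "countable G"
proof (rule countable_image_inj_on)
  let ?f = "\<lambda>h. interior (h ` P)"
  show "countable (?f ` G)"
  proof (rule countable_disjoint_open_subsets)
    show "pairwise disjnt (?f ` G)" unfolding pairwise_def disjnt_def using disj by blast
  qed auto
  show "inj_on ?f G"
    using disj tile_interior_nonempty unfolding inj_on_def by (metis inf.idem)
qed

text \<open>Tiles have disjoint nonempty interiors, so there are only countably many of them; the line has
  uncountably many points in \<open>H3\<close> and cannot meet every tile at most once.\<close>

lemma line_meets_tile_twice:
  assumes cover: "(\<Union>h\<in>G. h ` P) = H3" and x: "x \<in> H3" and v: "v \<noteq> 0"
  obtains h a b s t where "h \<in> G" "a \<in> P" "b \<in> P" "a \<noteq> b" "h a = x + s *\<^sub>R v" "h b = x + t *\<^sub>R v"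
proof -
  define A where "A = {x + s *\<^sub>R v |s. True} \<inter> H3"
  obtain r where r: "r > 0" "ball x r \<subseteq> H3" using x open_ball open_contains_ball by metis
  obtain t where t: "t > 0" "\<And>s. \<bar>s\<bar> \<le> t \<Longrightarrow> x + s *\<^sub>R v \<in> ball x r"
    using small_step[OF r(1)] by metis
  have "closed_segment x (x + t *\<^sub>R v) \<subseteq> A"
  proof
    fix z assume "z \<in> closed_segment x (x + t *\<^sub>R v)"
    then obtain u where u: "0 \<le> u" "u \<le> 1" "z = (1 - u) *\<^sub>R x + u *\<^sub>R (x + t *\<^sub>R v)" by (auto simp: in_segment)
    then have z: "z = x + (u * t) *\<^sub>R v" by (simp add: algebra_simps)
    have "\<bar>u * t\<bar> \<le> t" using u t(1) by (simp add: abs_mult mult_left_le_one_le)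
    then have "z \<in> H3" using t(2) r(2) z by blast
    then show "z \<in> A" using z unfolding A_def by blast
  qed
  moreover have "uncountable (closed_segment x (x + t *\<^sub>R v))"
    using t(1) v by (intro uncountable_closed_segment) simp
  ultimately have unc: "uncountable A" using countable_subset by blast
  have "\<exists>h\<in>G. uncountable (A \<inter> h ` P)"
  proof (rule ccontr)
    assume "\<not> ?thesis"
    then have "countable (\<Union>h\<in>G. A \<inter> h ` P)" using countable_G by (intro countable_UN) auto
    moreover have "(\<Union>h\<in>G. A \<inter> h ` P) = A" using cover unfolding A_def by blast
    ultimately show False using unc by simp
  qed
  then obtain h where h: "h \<in> G" "uncountable (A \<inter> h ` P)" by blast
  have "\<exists>y\<in>A \<inter> h ` P. \<exists>z\<in>A \<inter> h ` P. y \<noteq> z"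
  proof (rule ccontr)
    assume no: "\<not> ?thesis"
    have "A \<inter> h ` P \<noteq> {}" using h(2) by auto
    then obtain y where "y \<in> A \<inter> h ` P" by blast
    then have "A \<inter> h ` P \<subseteq> {y}" using no by blast
    then show False using h(2) by (metis countable_empty countable_insert countable_subset)
  qed
  then obtain y z where yz: "y \<in> A" "y \<in> h ` P" "z \<in> A" "z \<in> h ` P" "y \<noteq> z" by blast
  obtain a b where "a \<in> P" "b \<in> P" "y = h a" "z = h b" using yz by blast
  moreover obtain s s' where "y = x + s *\<^sub>R v" "z = x + s' *\<^sub>R v" using yz unfolding A_def by blast
  ultimately show ?thesis using that[of h a b s s'] h(1) yz(5) by auto
qed

end

end

section \<open>Edge classes\<close>

locale tessellation = kleinian G for G +
  fixes P :: "point set" and opp :: "point set \<Rightarrow> point set" and g :: "point set \<Rightarrow> point \<Rightarrow> point"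
  assumes fundamental: "fundamental_polyhedron G P opp g"
begin

lemma polyhedron: "convex_polyhedron P"
  using fundamental unfolding fundamental_polyhedron_def by (elim conjE)

lemma polyhedron_subset_H3: "P \<subseteq> H3"
  using convex_polyhedron_D[OF polyhedron] by blast

lemma tiles_cover: "(\<Union>h\<in>G. h ` P) = H3"
  using fundamental unfolding fundamental_polyhedron_def by (elim conjE)

lemma tiles_disjoint: "h \<in> G \<Longrightarrow> k \<in> G \<Longrightarrow> h \<noteq> k \<Longrightarrow> interior (h ` P) \<inter> interior (k ` P) = {}"
proof -
  have "\<forall>h\<in>G. \<forall>k\<in>G. h \<noteq> k \<longrightarrow> interior (h ` P) \<inter> interior (k ` P) = {}"
    using fundamental unfolding fundamental_polyhedron_def by (elim conjE)
  then show "h \<in> G \<Longrightarrow> k \<in> G \<Longrightarrow> h \<noteq> k \<Longrightarrow> interior (h ` P) \<inter> interior (k ` P) = {}" by blast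
qed

lemma pairing:
  assumes "\<sigma> facet_of P"
  shows "opp \<sigma> facet_of P" "opp (opp \<sigma>) = \<sigma>" "g \<sigma> \<in> G" "g \<sigma> ` \<sigma> = opp \<sigma>" "g \<sigma> ` P \<inter> P = opp \<sigma>"
proof -
  have "face_pairing G P opp g" using fundamental unfolding fundamental_polyhedron_def by (elim conjE)
  then show "opp \<sigma> facet_of P" "opp (opp \<sigma>) = \<sigma>" "g \<sigma> \<in> G" "g \<sigma> ` \<sigma> = opp \<sigma>" "g \<sigma> ` P \<inter> P = opp \<sigma>"
    using assms unfolding face_pairing_def by blast+
qed

text \<open>The identification maps faces of \<open>\<sigma>\<close> to faces of \<open>opp \<sigma>\<close>, and lines to lines.\<close>

lemma edge_image:
  assumes e: "e edge_of P" and \<sigma>: "\<sigma> facet_of P" "e \<subseteq> \<sigma>"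
  shows "g \<sigma> ` e edge_of P"
proof -
  note p = pairing[OF \<sigma>(1)]
  have face: "e face_of P" and dim: "aff_dim e = 1" using e by (auto simp: edge_of_def)
  have \<sigma>_subset: "\<sigma> \<subseteq> P" using \<sigma>(1) facet_of_imp_subset by blast
  then have eH: "e \<subseteq> H3" using \<sigma>(2) polyhedron_subset_H3 by blast
  have "e face_of \<sigma>" using face_of_subset[OF face \<sigma>(2) \<sigma>_subset] .
  then have "g \<sigma> ` e face_of opp \<sigma>" using face_of_image[OF p(3) _ _, of \<sigma> e] \<sigma>_subset polyhedron_subset_H3 p(4) by auto
  moreover have "opp \<sigma> face_of P" using p(1) facet_of_imp_face_of by blast
  ultimately have f: "g \<sigma> ` e face_of P" by (rule face_of_trans)
  obtain x d where x: "d \<noteq> 0" "x \<in> e" "x + d \<in> e" using edge_has_midpoint[OF polyhedron e] by metis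
  have xH: "x \<in> H3" "x + d \<in> H3" using x eH by auto
  have "g \<sigma> ` e \<subseteq> affine hull {g \<sigma> x, g \<sigma> (x + d)}"
  proof (rule image_subsetI)
    fix z assume z: "z \<in> e"
    obtain t where "z = x + t *\<^sub>R d" using collinear_edge[OF dim x(2,3,1) z] by blast
    then have "z = (1 - t) *\<^sub>R x + t *\<^sub>R (x + d)" by (simp add: algebra_simps)
    then have "z \<in> affine hull {x, x + d}" unfolding affine_hull_2 by (intro CollectI exI[of _ "1 - t"] exI[of _ t]) simp
    then show "g \<sigma> z \<in> affine hull {g \<sigma> x, g \<sigma> (x + d)}"
      using image_affine_hull_2[OF p(3) xH] z eH by blast
  qed
  then have "aff_dim (g \<sigma> ` e) \<le> aff_dim {g \<sigma> x, g \<sigma> (x + d)}" by (metis aff_dim_subset aff_dim_affine_hull)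
  moreover have "aff_dim {g \<sigma> x, g \<sigma> (x + d)} \<le> aff_dim (g \<sigma> ` e)" using x by (intro aff_dim_subset) auto
  moreover have "g \<sigma> x \<noteq> g \<sigma> (x + d)" using inj_H3[OF p(3) xH] x(1) by auto
  ultimately have "aff_dim (g \<sigma> ` e) = 1" by simp
  with f show ?thesis by (simp add: edge_of_def)
qed

lemma flag_orbit:
  assumes e: "e edge_of P" and \<sigma>: "\<sigma> facet_of P" "e \<subseteq> \<sigma>"
  shows "\<exists>e' \<sigma>' h. (next_flag P opp g ^^ i) (e, \<sigma>) = (e', \<sigma>') \<and> e' edge_of P \<and> \<sigma>' facet_of P \<and>
    e' \<subseteq> \<sigma>' \<and> h \<in> G \<and> h ` e = e'"
proof (induction i)
  case 0
  have "e \<subseteq> H3" using e edge_of_imp_subset polyhedron_subset_H3 by blast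
  then have "\<one>\<^bsub>BijGroup H3\<^esub> ` e = e"
    using one_apply by (auto simp: subset_iff image_iff simp del: mem_ball_0)
  then show ?case using e \<sigma> one_in by auto
next
  case (Suc i)
  then obtain e' \<sigma>' h where *: "(next_flag P opp g ^^ i) (e, \<sigma>) = (e', \<sigma>')"
    "e' edge_of P" "\<sigma>' facet_of P" "e' \<subseteq> \<sigma>'" "h \<in> G" "h ` e = e'" by blast
  note p = pairing[OF *(3)]
  let ?e = "g \<sigma>' ` e'" let ?\<sigma> = "other_face P ?e (opp \<sigma>')"
  have e': "?e edge_of P" using edge_image[OF *(2-4)] .
  have "?e \<subseteq> opp \<sigma>'" using *(4) p(4) by blast
  then have \<sigma>': "?\<sigma> facet_of P" "?e \<subseteq> ?\<sigma>" using other_face_facet[OF polyhedron e' p(1)] by blast+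
  have "e \<subseteq> H3" using e edge_of_imp_subset polyhedron_subset_H3 by blast
  then have "(g \<sigma>' \<otimes>\<^bsub>BijGroup H3\<^esub> h) ` e = g \<sigma>' ` (h ` e)"
    unfolding image_image using mult_apply[OF p(3) *(5)] by (intro image_cong) auto
  then have "(g \<sigma>' \<otimes>\<^bsub>BijGroup H3\<^esub> h) ` e = ?e" using *(6) by simp
  moreover have "(next_flag P opp g ^^ Suc i) (e, \<sigma>) = (?e, ?\<sigma>)" using *(1) by (simp add: next_flag_def)
  ultimately show ?case using e' \<sigma>' mult_in[OF p(3) *(5)] by blast
qed

lemma edge_class_orbit:
  assumes "e edge_of P" "\<sigma> facet_of P" "e \<subseteq> \<sigma>" "e' \<in> edge_class P opp g (e, \<sigma>)"
  shows "e' edge_of P" "\<exists>h\<in>G. h ` e = e'"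
proof -
  obtain i where "e' = fst ((next_flag P opp g ^^ i) (e, \<sigma>))"
    using assms(4) unfolding edge_class_def by blast
  then show "e' edge_of P" "\<exists>h\<in>G. h ` e = e'" using flag_orbit[OF assms(1-3), of i] by fastforce+
qed

text \<open>Choose for each edge \<open>e'\<close> of the class an element of \<open>G\<close> that maps \<open>e\<close> to \<open>e'\<close>.  The tiles of these elements
  already fill the full turn around \<open>e\<close>.  A nontrivial \<open>k\<close> that fixes \<open>e\<close> pointwise maps \<open>e\<close> to itself, as
  the identity does; so it can be kept apart from the chosen elements and gives one more tile, of
  positive angle.\<close>

lemma fixes_edge_imp_one:
  assumes e: "e edge_of P" and \<sigma>: "\<sigma> facet_of P" "e \<subseteq> \<sigma>"
    and sum: "(\<Sum>e'\<in>edge_class P opp g (e, \<sigma>). dihedral_angle P e') = 2 * pi"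
    and k: "k \<in> G" "\<And>z. z \<in> e \<Longrightarrow> k z = z"
  shows "k = \<one>\<^bsub>BijGroup H3\<^esub>"
proof (rule ccontr)
  assume ne: "k \<noteq> \<one>\<^bsub>BijGroup H3\<^esub>"
  let ?C = "edge_class P opp g (e, \<sigma>)"
  have finC: "finite ?C" by (simp add: edge_class_def)
  have eH: "e \<subseteq> H3" using e edge_of_imp_subset polyhedron_subset_H3 by blast
  have one: "\<one>\<^bsub>BijGroup H3\<^esub> ` e = e"
    using one_apply eH by (auto simp: subset_iff image_iff simp del: mem_ball_0)
  have ke: "k ` e = e" using k(2) by (auto simp: image_iff)
  have "\<exists>h\<in>G. h ` e = e' \<and> h \<noteq> k" if "e' \<in> ?C" for e'
  proof (cases "e' = e")
    case True then show ?thesis using one one_in ne by metis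
  next
    case False then show ?thesis using edge_class_orbit(2)[OF e \<sigma> that] ke by metis
  qed
  then obtain \<kappa> where \<kappa>: "\<And>e'. e' \<in> ?C \<Longrightarrow> \<kappa> e' \<in> G \<and> \<kappa> e' ` e = e' \<and> \<kappa> e' \<noteq> k" by metis
  have inj: "inj_on \<kappa> ?C" using \<kappa> by (metis inj_onI)
  have "(\<Sum>h\<in>insert k (\<kappa> ` ?C). dihedral_angle P (h ` e)) \<le> 2 * pi"
  proof (rule sum_dihedral_angles_le[OF polyhedron tiles_disjoint e])
    show "finite (insert k (\<kappa> ` ?C))" using finC by simp
    show "insert k (\<kappa> ` ?C) \<subseteq> G" using k(1) \<kappa> by blast
    fix h assume "h \<in> insert k (\<kappa> ` ?C)"
    then show "h ` e edge_of P" using ke e \<kappa> edge_class_orbit(1)[OF e \<sigma>] by auto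
  qed
  moreover have "k \<notin> \<kappa> ` ?C" using \<kappa> by blast
  ultimately have "dihedral_angle P (k ` e) + (\<Sum>h\<in>\<kappa> ` ?C. dihedral_angle P (h ` e)) \<le> 2 * pi"
    using finC by simp
  moreover have "(\<Sum>h\<in>\<kappa> ` ?C. dihedral_angle P (h ` e)) = (\<Sum>e'\<in>?C. dihedral_angle P e')"
    unfolding sum.reindex[OF inj] by (intro sum.cong refl) (simp add: \<kappa>)
  ultimately show False using sum ke dihedral_angle_bounds(1)[OF polyhedron e] by simp
qed

text \<open>The midpoint \<open>x\<close> of a fixed segment is in the interior of \<open>P\<close>, or inside a facet, or inside an edge.  In
  the first case \<open>P\<close> and its image overlap.  In the second, the image is the tile across the facet,
  so that \<open>k\<close> is a face pairing transformation, which would be elliptic.  In the third, the segment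
  lies in the edge, and \<open>k\<close> fixes the whole edge.\<close>

lemma fixes_segment_imp_one:
  assumes ell: "\<And>\<sigma>. \<sigma> facet_of P \<Longrightarrow> \<not> elliptic (g \<sigma>)"
    and sum: "\<And>e \<sigma>. e edge_of P \<Longrightarrow> \<sigma> facet_of P \<Longrightarrow> e \<subseteq> \<sigma> \<Longrightarrow>
      (\<Sum>e'\<in>edge_class P opp g (e, \<sigma>). dihedral_angle P e') = 2 * pi"
    and k: "k \<in> G" and a: "a \<in> P" "k a = a" and b: "b \<in> P" "k b = b" and ab: "a \<noteq> b"
  shows "k = \<one>\<^bsub>BijGroup H3\<^esub>"
proof (rule ccontr)
  assume ne: "k \<noteq> \<one>\<^bsub>BijGroup H3\<^esub>"
  define x where "x = a + (1/2) *\<^sub>R (b - a)"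
  define d where "d = (1/2) *\<^sub>R (b - a)"
  have d: "d \<noteq> 0" using ab by (simp add: d_def)
  have xa: "x - d = a" by (simp add: x_def d_def)
  have xb: "x + d = b" by (simp add: x_def d_def vec_eq_iff field_simps)
  have xP: "x \<in> P" unfolding x_def using convex_step[OF convex_polyhedron_D(3)[OF polyhedron] a(1) b(1)] by simp
  have H: "a \<in> H3" "b \<in> H3" "x \<in> H3" using a b xP polyhedron_subset_H3 by blast+
  have line: "k z = z" if "z \<in> H3" "z = x + t *\<^sub>R d" for z t
  proof (rule fixes_line[OF k H(1) a(2) H(2) b(2) that(1)])
    show "z = (1 - (1 + t) / 2) *\<^sub>R a + ((1 + t) / 2) *\<^sub>R b"
      unfolding that(2) x_def d_def by (simp add: vec_eq_iff field_simps)
  qed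
  have kx: "k x = x" using line[OF H(3), of 0] by simp
  then have xk: "x \<in> k ` P" using xP by (metis imageI)
  from convex_polyhedron_local_structure[OF polyhedron xP d] xa xb a(1) b(1)
  consider "x \<in> interior P" | c where "locally_halfspace P x c" | c c' where "locally_wedge P x d c c'"
    by metis
  then show False
  proof cases
    case 1
    then have "x \<in> interior (k ` P)" using image_interior[OF k polyhedron_subset_H3] kx by (metis imageI subsetD)
    then show ?thesis using disjoint_from_P[OF polyhedron tiles_disjoint k ne] 1 by blast
  next
    case (2 c)
    define \<sigma> where "\<sigma> = wall P x c"
    have \<sigma>: "\<sigma> facet_of P" unfolding \<sigma>_def using locally_halfspace_facet[OF polyhedron xP 2] by blast
    note p = pairing[OF \<sigma>] and p' = pairing[OF pairing(1)[OF \<sigma>]]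
    have "g (opp \<sigma>) \<noteq> \<one>\<^bsub>BijGroup H3\<^esub>"
    proof
      assume "g (opp \<sigma>) = \<one>\<^bsub>BijGroup H3\<^esub>"
      then have "P = \<sigma>" using p'(5) p(2) one_image[OF polyhedron tiles_disjoint] by simp
      then show False using \<sigma> by (simp add: facet_of_irrefl)
    qed
    moreover have "\<sigma> \<subseteq> g (opp \<sigma>) ` P" using p'(5) p(2) by blast
    ultimately have "g (opp \<sigma>) = k"
      using only_tile_beyond_wall[OF polyhedron tiles_disjoint 2 p'(3) _ _ xP k ne xk] unfolding \<sigma>_def by blast
    moreover have "elliptic k" unfolding elliptic_def using isometry[OF k] ne H(3) kx by blast
    ultimately show ?thesis using ell[OF p(1)] by simp
  next
    case (3 c c')
    have xd: "x + d \<in> P" "x - d \<in> P" using xa xb a b by auto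
    let ?e = "wall P x c \<inter> wall P x c'"
    note E = locally_wedge_edge[OF polyhedron xP d xd(1) 3]
    note W = edge_walls[OF polyhedron E(1,2) d xd 3]
    have "k z = z" if z: "z \<in> ?e" for z
    proof -
      have "aff_dim ?e = 1" using E(1) by (simp add: edge_of_def)
      then obtain t where "z = x + t *\<^sub>R d" using collinear_edge[OF _ E(2,3) d z] by blast
      moreover have "z \<in> H3" using z polyhedron_subset_H3 by (auto simp: wall_def)
      ultimately show ?thesis by (rule line[rotated])
    qed
    then show ?thesis using fixes_edge_imp_one[OF E(1) W(1,4) sum[OF E(1) W(1,4)] k] ne by blast
  qed
qed

end

section \<open>Torsion\<close>

theorem corollary3p1:
  fixes G :: "(point \<Rightarrow> point) set" and P :: "point set"
    and opp :: "point set \<Rightarrow> point set" and g :: "point set \<Rightarrow> point \<Rightarrow> point"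
  assumes "kleinian_group G"
    and "fundamental_polyhedron G P opp g"
    and "\<And>\<sigma>. \<sigma> facet_of P \<Longrightarrow> \<not> elliptic (g \<sigma>)"
    and "\<And>e \<sigma>. e edge_of P \<Longrightarrow> \<sigma> facet_of P \<Longrightarrow> e \<subseteq> \<sigma> \<Longrightarrow>
           (\<Sum>e'\<in>edge_class P opp g (e, \<sigma>). dihedral_angle P e') = 2 * pi"
  shows "torsion_free G"
proof -
  interpret tessellation G P opp g
    using assms(1,2) by unfold_locales
  show ?thesis
    unfolding torsion_free_def
  proof (intro ballI allI impI)
    fix f and n :: nat assume f: "f \<in> G" and n: "n > 0" and tors: "f [^]\<^bsub>BijGroup H3\<^esub> n = \<one>\<^bsub>BijGroup H3\<^esub>"
    have pow: "f [^]\<^bsub>BijGroup H3\<^esub> m \<in> G \<and> (\<forall>x\<in>H3. (f [^]\<^bsub>BijGroup H3\<^esub> m) x = (f ^^ m) x)" for m :: nat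
    proof (induction m)
      case 0 show ?case using one_in one_apply by (simp del: mem_ball_0)
    next
      case (Suc m)
      have "(f [^]\<^bsub>BijGroup H3\<^esub> Suc m) x = (f ^^ Suc m) x" if x: "x \<in> H3" for x
      proof -
        have "(f [^]\<^bsub>BijGroup H3\<^esub> Suc m) x = (f [^]\<^bsub>BijGroup H3\<^esub> m) (f x)"
          using mult_apply[OF conjunct1[OF Suc] f x] by simp
        also have "\<dots> = (f ^^ m) (f x)" using Suc maps_H3[OF f x] by blast
        finally show ?thesis by (simp add: funpow_swap1)
      qed
      then show ?case using mult_in[OF conjunct1[OF Suc] f] by simp
    qed
    have per: "(f ^^ n) x = x" if "x \<in> H3" for x using pow[of n] tors one_apply[OF that] that by metis
    obtain L where L: "lifts_to f L" using obtain_lift[OF f] .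
    obtain x where x: "x \<in> H3" "f x = x" using finite_order_imp_fixed_point[OF L maps_H3[OF f] n per] .
    obtain v where v: "v \<noteq> 0" "\<And>t. L (1, x + t *\<^sub>R v) = (1, x + t *\<^sub>R v)"
      using orientation_preserving_fixed_point_imp_axis[OF isometry[OF f] L x] by metis
    obtain h a b s t where h: "h \<in> G" and ab: "a \<in> P" "b \<in> P" "a \<noteq> b"
      and ha: "h a = x + s *\<^sub>R v" "h b = x + t *\<^sub>R v"
      by (rule line_meets_tile_twice[OF polyhedron tiles_disjoint tiles_cover x(1) v(1)]) (assumption | rule that)+
    have H: "a \<in> H3" "b \<in> H3" using ab polyhedron_subset_H3 by blast+
    have fixed: "f (h a) = h a" "f (h b) = h b"
      using lifts_to_fixed[OF L maps_H3[OF h H(1)] maps_H3[OF f maps_H3[OF h H(1)]]]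
        lifts_to_fixed[OF L maps_H3[OF h H(2)] maps_H3[OF f maps_H3[OF h H(2)]]] v(2) ha by auto
    \<comment> \<open>Moving the tile that contains a segment of the axis back to \<open>P\<close> conjugates \<open>f\<close> to \<open>k\<close>.\<close>
    define k where "k = inverse_map h \<otimes>\<^bsub>BijGroup H3\<^esub> (f \<otimes>\<^bsub>BijGroup H3\<^esub> h)"
    have kG: "k \<in> G" unfolding k_def using mult_in inverse_in h f by metis
    have k: "k y = inverse_map h (f (h y))" if "y \<in> H3" for y
      unfolding k_def using mult_apply[OF inverse_in[OF h] mult_in[OF f h] that] mult_apply[OF f h that] by simp
    have "k a = a" "k b = b" using k[OF H(1)] k[OF H(2)] fixed inverse_left[OF h] H by auto
    then have one: "k = \<one>\<^bsub>BijGroup H3\<^esub>"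
      using fixes_segment_imp_one[OF assms(3,4) kG ab(1) _ ab(2) _ ab(3)] by blast
    show "f = \<one>\<^bsub>BijGroup H3\<^esub>"
    proof (rule eqI[OF f one_in])
      fix y assume y: "y \<in> H3"
      define z where "z = inverse_map h y"
      have z: "z \<in> H3" "h z = y" using maps_H3[OF inverse_in[OF h] y] inverse_right[OF h y] by (auto simp: z_def)
      have "inverse_map h (f y) = z" using k[OF z(1)] one one_apply[OF z(1)] z(2) by simp
      then have "f y = y" using inverse_right[OF h maps_H3[OF f y]] z(2) by simp
      then show "f y = \<one>\<^bsub>BijGroup H3\<^esub> y" using one_apply[OF y] by simp
    qed
  qed
qed

end
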